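(* Let $K,K_i\in\mathcal S^n_o$ and $\varphi,\varphi_j\in\Phi$, $i,j\in\mathbb N$. If $K_i\to K$ and $\varphi_j\to\varphi$, then $$\lim_{i,j\to\infty}\mathrm L_{\varphi_j}K_i=\mathrm L_\varphi K.$$
   Context: Work in $\mathbb R^n$; $V$ is volume, $S$ spherical Lebesgue measure on the unit sphere $S^{n-1}$. $\Phi$ is the class of convex, strictly increasing functions $\varphi:[0,\infty)\to[0,\infty)$ with $\varphi(0)=0$; $\varphi_j\to\varphi$ means uniform convergence on every compact interval $I\subset[0,\infty)$. For a compact set $K$ that is star-shaped about the origin, the radial function is $\rho_K(x)=\sup\{\lambda\ge0:\lambda x\in K\}$, $x\ne o$; $\mathcal S^n_o$ is the class of star bodies about the origin $o$, i.e. compact sets $K$ with $\lambda x\in K$ for all $x\in K,\lambda\in[0,1]$, with $o\in\operatorname{int}K$ and $\rho_K$ continuous on $S^{n-1}$. Convergence of star bodies (including ellipsoids) is with respect to the dual Hausdorff metric $\tilde\delta_H(K_1,K_2)=\max_{u\in S^{n-1}}|\rho_{K_1}(u)-\rho_{K_2}(u)|$. $\mathcal E^n$ is the class of (nondegenerate, $n$-dimensional) origin-symmetric ellipsoids. $V_K^*$ is the probability measure on $S^{n-1}$ with $dV_K^*=\frac{\rho_K^n}{nV(K)}\,dS$. For $K,L\in\mathcal S^n_o$, $$O_\varphi(K,L)=\inf\left\{\lambda>0:\ \varphi^{-1}\left(\int_{S^{n-1}}\varphi\left(\frac{\rho_K}{\lambda\rho_L}\right)dV_K^*\right)\le1\right\}.$$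 The Orlicz-Legendre ellipsoid $\mathrm L_\varphi K$ is the unique $E\in\mathcal E^n$ that minimizes $V(E)$ subject to $O_\varphi(K,E)\le1$ (existence and uniqueness hold for all $K\in\mathcal S^n_o$, $\varphi\in\Phi$). The limit is a joint double limit as $i,j\to\infty$. *)

theory Defs
  imports "HOL-Analysis.Analysis"
begin

definition Orlicz_class :: "(real \<Rightarrow> real) set" where
  \<comment> \<open>Functions on \<open>[0,\<infinity>)\<close> are represented by total functions; values at negative arguments
     are never used.\<close>
  "Orlicz_class = {\<phi>. \<phi> ` {0..} \<subseteq> {0..} \<and> convex_on {0..} \<phi> \<and>
                      strict_mono_on {0..} \<phi> \<and> \<phi> 0 = 0}"

definition Orlicz_tendsto :: "(nat \<Rightarrow> real \<Rightarrow> real) \<Rightarrow> (real \<Rightarrow> real) \<Rightarrow> bool" where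
  "Orlicz_tendsto \<phi>s \<phi> \<longleftrightarrow> (\<forall>a b. 0 \<le> a \<longrightarrow> uniform_limit {a..b} \<phi>s \<phi> sequentially)"

definition vol :: "(real ^ 'n) set \<Rightarrow> real" where
  "vol A = measure lebesgue A"

definition radial :: "(real ^ 'n) set \<Rightarrow> real ^ 'n \<Rightarrow> real" where
  "radial K x = Sup {c. 0 \<le> c \<and> c *\<^sub>R x \<in> K}"

definition star_body :: "(real ^ 'n) set \<Rightarrow> bool" where
  "star_body K \<longleftrightarrow> compact K \<and> (\<forall>x\<in>K. \<forall>c\<in>{0..1}. c *\<^sub>R x \<in> K) \<and>
                   0 \<in> interior K \<and> continuous_on (sphere 0 1) (radial K)"

definition dual_hausdorff :: "(real ^ 'n) set \<Rightarrow> (real ^ 'n) set \<Rightarrow> real" where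
  "dual_hausdorff K L = (SUP u\<in>sphere 0 1. \<bar>radial K u - radial L u\<bar>)"

definition ellipsoid :: "(real ^ 'n) set \<Rightarrow> bool" where
  "ellipsoid E \<longleftrightarrow> (\<exists>A :: real ^ 'n ^ 'n. invertible A \<and> E = (\<lambda>x. A *v x) ` cball 0 1)"

text \<open>Spherical Lebesgue measure, given by polar coordinates: the measure of \<open>A\<close> is \<open>n\<close> times the
  volume of the cone over \<open>A\<close> in the unit ball (see \<open>emeasure_sphere_measure\<close> below). For \<open>n = 1\<close>
  it is counting measure on \<open>{-1, 1}\<close>.\<close>

definition sphere_measure :: "(real ^ 'n) measure" where
  "sphere_measure =
     distr (restrict_space (scale_measure (of_nat CARD('n)) lborel) (cball 0 1 - {0}))
           (restrict_space borel (sphere 0 1)) (\<lambda>x. x /\<^sub>R norm x)"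

lemma emeasure_sphere_measure:
  fixes A :: "(real ^ 'n) set"
  assumes "A \<in> sets borel" "A \<subseteq> sphere 0 1"
  shows "emeasure sphere_measure A =
         of_nat CARD('n) * emeasure lborel {r *\<^sub>R u | r u. 0 < r \<and> r \<le> 1 \<and> u \<in> A}"
proof -
  let ?B = "cball 0 1 - {0} :: (real ^ 'n) set"
  let ?M = "restrict_space (scale_measure (of_nat CARD('n)) lborel) ?B"
  let ?f = "\<lambda>x :: real ^ 'n. x /\<^sub>R norm x"
  have B: "?B \<in> sets borel" by auto
  have sp: "space ?M = ?B" by (simp add: space_restrict_space space_scale_measure)
  have sM: "sets ?M = sets (restrict_space borel ?B)"
    by (rule sets_restrict_space_cong) simp
  have "?f \<in> borel_measurable (restrict_space borel ?B)"
    by (intro borel_measurable_continuous_on_restrict continuous_intros) auto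
  then have "?f \<in> borel_measurable ?M"
    using measurable_cong_sets[OF sM refl] by blast
  then have f: "?f \<in> measurable ?M (restrict_space borel (sphere 0 1))"
    by (intro measurable_restrict_space2) (auto simp: sp)
  have A: "A \<in> sets (restrict_space borel (sphere 0 1))"
    using assms by (auto simp: sets_restrict_space_iff)
  have pre: "?f -` A \<inter> space ?M = {r *\<^sub>R u | r u. 0 < r \<and> r \<le> 1 \<and> u \<in> A}" (is "_ = ?C")
  proof (intro set_eqI iffI)
    fix x assume x: "x \<in> ?f -` A \<inter> space ?M"
    then have "x = norm x *\<^sub>R ?f x" "0 < norm x" "norm x \<le> 1" "?f x \<in> A"
      by (auto simp: sp)
    then show "x \<in> ?C" by blast
  next
    fix x assume "x \<in> ?C"
    then obtain r u where "x = r *\<^sub>R u" "0 < r" "r \<le> 1" "u \<in> A" by auto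
    moreover from this assms have "norm u = 1" by auto
    ultimately show "x \<in> ?f -` A \<inter> space ?M" by (auto simp: sp)
  qed
  have "emeasure sphere_measure A = emeasure ?M ?C"
    unfolding sphere_measure_def using emeasure_distr[OF f A] pre by simp
  also have "\<dots> = emeasure (scale_measure (of_nat CARD('n)) lborel) ?C"
    using pre sp by (intro emeasure_restrict_space) (use B in auto)
  finally show ?thesis by simp
qed

definition dual_cone_measure :: "(real ^ 'n) set \<Rightarrow> (real ^ 'n) measure" where
  "dual_cone_measure K =
     density sphere_measure (\<lambda>u. ennreal (radial K u ^ CARD('n) / (real CARD('n) * vol K)))"

definition Orlicz_functional ::
    "(real \<Rightarrow> real) \<Rightarrow> (real ^ 'n) set \<Rightarrow> (real ^ 'n) set \<Rightarrow> real" where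
  "Orlicz_functional \<phi> K L =
     Inf {c. 0 < c \<and>
          inv_into {0..} \<phi> (\<integral>u. \<phi> (radial K u / (c * radial L u)) \<partial>dual_cone_measure K) \<le> 1}"

definition is_Orlicz_Legendre_ellipsoid ::
    "(real \<Rightarrow> real) \<Rightarrow> (real ^ 'n) set \<Rightarrow> (real ^ 'n) set \<Rightarrow> bool" where
  "is_Orlicz_Legendre_ellipsoid \<phi> K E \<longleftrightarrow>
     ellipsoid E \<and> Orlicz_functional \<phi> K E \<le> 1 \<and>
     (\<forall>E'. ellipsoid E' \<and> Orlicz_functional \<phi> K E' \<le> 1 \<longrightarrow> vol E \<le> vol E')"

definition Orlicz_Legendre_ellipsoid ::
    "(real \<Rightarrow> real) \<Rightarrow> (real ^ 'n) set \<Rightarrow> (real ^ 'n) set" where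
  "Orlicz_Legendre_ellipsoid \<phi> K = (THE E. is_Orlicz_Legendre_ellipsoid \<phi> K E)"

end

theory Submission imports Defs begin

text \<open>Write an ellipsoid as \<open>{x. |B x| \<le> 1}\<close>. Its radial function at a unit vector \<open>u\<close> is
  \<open>1 / |B u|\<close> and its volume is proportional to \<open>1 / |det B|\<close>, so \<open>L\<^sub>\<phi> K\<close> is given by the matrices \<open>B\<close>
  that maximise \<open>|det B|\<close> subject to \<open>\<integral> \<phi>(\<rho>\<^sub>K(u) |B u|) dV\<^sub>K\<^sup>*(u) \<le> \<phi>(1)\<close>. The constraint is convex in \<open>B\<close> and
  coercive, locally uniformly in \<open>K\<close> and uniformly in \<open>\<phi>\<close>, because \<open>\<phi>(x) \<ge> \<phi>(1) (x - 1)\<close>; this yields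
  maximisers. For uniqueness, replace one of two maximisers \<open>A\<close>, \<open>B\<close> by \<open>Q A\<close> with \<open>Q\<close> orthogonal, chosen
  by a singular value decomposition of \<open>A B\<^sup>-\<^sup>1\<close> such that the midpoint of \<open>Q A\<close> and \<open>B\<close> has a larger
  determinant unless \<open>A\<close> and \<open>B\<close> give the same ellipsoid. The integral is jointly continuous in
  \<open>(\<phi>, K, B)\<close>, hence any limit point of maximisers for \<open>(\<phi>\<^sub>j, K\<^sub>i)\<close> is feasible for \<open>(\<phi>, K)\<close>; it is
  maximal because \<open>t B\<close> with \<open>t < 1\<close> is strictly feasible whenever \<open>B\<close> is feasible, and so it remains
  feasible for \<open>(\<phi>\<^sub>j, K\<^sub>i)\<close> with large \<open>i\<close>, \<open>j\<close>.\<close>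

subsection \<open>Singular values and determinants\<close>

definition reflection_matrix :: "real ^ 'n \<Rightarrow> real ^ 'n ^ 'n" where
  "reflection_matrix v = (\<chi> i j. (if i = j then 1 else 0) - 2 * v $ i * v $ j / (v \<bullet> v))"

definition diagonal_matrix :: "('n \<Rightarrow> real) \<Rightarrow> real ^ 'n ^ 'n" where
  "diagonal_matrix s = (\<chi> i j. if i = j then s i else 0)"

lemma reflection_matrix_mult_vec:
  fixes v x :: "real ^ 'n"
  shows "reflection_matrix v *v x = x - (2 * (v \<bullet> x) / (v \<bullet> v)) *\<^sub>R v"
proof -
  have "(\<Sum>j\<in>UNIV. 2 * v $ i * v $ j / (v \<bullet> v) * x $ j) = 2 * (v \<bullet> x) / (v \<bullet> v) * v $ i" for i
  proof -
    have "(\<Sum>j\<in>UNIV. 2 * v $ i * v $ j / (v \<bullet> v) * x $ j) =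
        (\<Sum>j\<in>UNIV. 2 * v $ i / (v \<bullet> v) * (v $ j * x $ j))"
      by (simp add: mult_ac)
    also have "\<dots> = 2 * v $ i / (v \<bullet> v) * (v \<bullet> x)"
      by (simp only: sum_distrib_left[symmetric] inner_vec_def[of v x] inner_real_def)
    finally show ?thesis by simp
  qed
  then show ?thesis
    by (simp add: vec_eq_iff reflection_matrix_def matrix_vector_mult_def left_diff_distrib
        sum_subtractf if_distrib[of "\<lambda>c. c * _"] cong: if_cong)
qed

lemma orthogonal_matrix_reflection:
  fixes v :: "real ^ 'n"
  assumes "v \<noteq> 0"
  shows "orthogonal_matrix (reflection_matrix v)"
proof -
  have "orthogonal_transformation ((*v) (reflection_matrix v))"
    unfolding orthogonal_transformation_def
  proof (intro conjI allI)
    show "linear ((*v) (reflection_matrix v))" by simp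
    fix x y
    show "(reflection_matrix v *v x) \<bullet> (reflection_matrix v *v y) = x \<bullet> y"
      using assms by (simp add: reflection_matrix_mult_vec inner_diff_left inner_diff_right
          inner_commute field_simps)
  qed
  then show ?thesis
    by (simp add: orthogonal_transformation_matrix)
qed

lemma trace_eq_sum_columns: "trace N = (\<Sum>i\<in>UNIV. column i N $ i)"
  by (simp add: trace_def column_def)

lemma column_matrix_mult: "column i (A ** B) = A *v column i B"
  by (simp add: column_def matrix_matrix_mult_def matrix_vector_mult_def vec_eq_iff)

text \<open>Reflections are explicit orthogonal matrices that change the trace by a multiple of the
  quadratic form of \<open>N\<close>, which makes them convenient test matrices for trace
  maximality.\<close>

lemma trace_reflection_mult:
  fixes N :: "real ^ 'n ^ 'n"
  shows "trace (reflection_matrix v ** N) = trace N - 2 * (v \<bullet> (N *v v)) / (v \<bullet> v)"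
proof -
  have "(\<Sum>i\<in>UNIV. (v \<bullet> column i N) * v $ i) = v \<bullet> (N *v v)"
    by (subst matrix_mult_sum) (simp add: inner_sum_right mult.commute scalar_mult_eq_scaleR)
  then have "(\<Sum>i\<in>UNIV. 2 * (v \<bullet> column i N) / (v \<bullet> v) * v $ i) = 2 * (v \<bullet> (N *v v)) / (v \<bullet> v)"
    by (simp add: sum_divide_distrib[symmetric] sum_distrib_left[symmetric] mult.assoc)
  then show ?thesis
    by (simp add: trace_eq_sum_columns column_matrix_mult reflection_matrix_mult_vec sum_subtractf)
qed

text \<open>Testing maximality with the reflection in \<open>v\<close> changes the trace by minus
  twice the Rayleigh quotient of \<open>N\<close> at \<open>v\<close>, so that quotient cannot be
  negative.\<close>

lemma trace_maximal_imp_psd: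
  fixes N :: "real ^ 'n ^ 'n"
  assumes "\<And>X. orthogonal_matrix X \<Longrightarrow> trace (X ** N) \<le> trace N"
  shows "0 \<le> v \<bullet> (N *v v)"
proof (cases "v = 0")
  case False
  then have "0 < v \<bullet> v" by simp
  with assms[OF orthogonal_matrix_reflection[OF False]] show ?thesis
    by (simp add: trace_reflection_mult zero_le_divide_iff)
qed simp

text \<open>The product of the reflections in \<open>e\<^sub>i\<close> and \<open>e\<^sub>i + \<epsilon> e\<^sub>j\<close> is a rotation by a small angle, and the
  first-order term in \<open>\<epsilon>\<close> of the trace is the antisymmetric part of \<open>N\<close>.\<close>

lemma trace_maximal_imp_le:
  fixes N :: "real ^ 'n ^ 'n"
  assumes max: "\<And>X. orthogonal_matrix X \<Longrightarrow> trace (X ** N) \<le> trace N" and ij: "i \<noteq> j"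
  shows "N $ j $ i \<le> N $ i $ j"
proof -
  define a c :: "real ^ 'n" where "a = axis i 1" and "c = axis j 1"
  have aa: "a \<bullet> a = 1" and ac: "a \<bullet> c = 0" "c \<bullet> a = 0" and cc: "c \<bullet> c = 1"
    using ij by (auto simp: a_def c_def inner_axis_axis)
  have N: "a \<bullet> (N *v c) = N $ i $ j" "c \<bullet> (N *v a) = N $ j $ i"
    by (auto simp: a_def c_def inner_axis' matrix_vector_mult_basis column_def)
  have key: "N $ j $ i - N $ i $ j \<le> e * (a \<bullet> (N *v a) + c \<bullet> (N *v c))" if e: "e > 0" for e
  proof -
    define b where "b = a + e *\<^sub>R c"
    have ab: "a \<bullet> b = 1" and bb: "b \<bullet> b = 1 + e\<^sup>2"
      by (simp_all add: b_def inner_add_left inner_add_right aa ac cc power2_eq_square)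
    have pos: "0 < 1 + e\<^sup>2" by (simp add: add_pos_nonneg)
    have nz: "a \<noteq> 0" "b \<noteq> 0" using aa bb pos by auto
    define p where "p = b \<bullet> (N *v a)"
    define q where "q = b \<bullet> (N *v b)"
    define r where "r = a \<bullet> (N *v a)"
    have "trace (reflection_matrix a ** (reflection_matrix b ** N)) \<le> trace N"
      using max[OF orthogonal_matrix_mul[OF orthogonal_matrix_reflection[OF nz(1)]
            orthogonal_matrix_reflection[OF nz(2)]]]
      by (simp add: matrix_mul_assoc)
    then have "0 \<le> 2 * q / (1 + e\<^sup>2) + 2 * (r - 2 * p / (1 + e\<^sup>2))"
      by (simp add: trace_reflection_mult matrix_vector_mul_assoc[symmetric]
          reflection_matrix_mult_vec inner_diff_right aa ab bb p_def q_def r_def)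
    then have "0 \<le> (2 * q / (1 + e\<^sup>2) + 2 * (r - 2 * p / (1 + e\<^sup>2))) * (1 + e\<^sup>2)"
      using pos by simp
    also have "\<dots> = 2 * q + 2 * r * (1 + e\<^sup>2) - 4 * p"
      using pos by (simp add: distrib_right right_diff_distrib left_diff_distrib)
    finally have "2 * p \<le> q + r * (1 + e\<^sup>2)" by simp
    moreover have "p = r + e * N $ j $ i"
      by (simp add: p_def r_def b_def inner_add_left N)
    moreover have "q = r + e * (N $ i $ j + N $ j $ i) + e\<^sup>2 * (c \<bullet> (N *v c))"
      by (simp add: q_def r_def b_def inner_add_left inner_add_right matrix_vector_right_distrib
          matrix_vector_mult_scaleR N power2_eq_square algebra_simps)
    \<comment> \<open>After substitution the terms \<open>2 * r\<close> cancel; what remains is the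
      antisymmetric part at order \<open>e\<close> against a bound of order
      \<open>e\<^sup>2\<close>, and one factor \<open>e\<close> can be divided out.\<close>
    ultimately have "e * (N $ j $ i - N $ i $ j) \<le> e * (e * (r + c \<bullet> (N *v c)))"
      by (simp add: algebra_simps power2_eq_square)
    then show ?thesis using e by (simp add: r_def)
  qed
  have "N $ j $ i - N $ i $ j \<le> 0"
  proof (rule tendsto_lowerbound[where F = "at_right 0"])
    show "((\<lambda>e. e * (a \<bullet> (N *v a) + c \<bullet> (N *v c))) \<longlongrightarrow> 0) (at_right 0)"
      by (auto intro!: tendsto_eq_intros)
    show "\<forall>\<^sub>F e in at_right 0. N $ j $ i - N $ i $ j \<le> e * (a \<bullet> (N *v a) + c \<bullet> (N *v c))"
      using key by (simp add: eventually_at_filter)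
  qed simp
  then show ?thesis by simp
qed

lemma trace_maximal_imp_symmetric:
  fixes N :: "real ^ 'n ^ 'n"
  assumes "\<And>X. orthogonal_matrix X \<Longrightarrow> trace (X ** N) \<le> trace N"
  shows "N $ i $ j = N $ j $ i"
  using trace_maximal_imp_le[OF assms, of i j] trace_maximal_imp_le[OF assms, of j i]
  by (cases "i = j") auto

lemma compact_orthogonal_matrices: "compact {Q :: real ^ 'n ^ 'n. orthogonal_matrix Q}"
proof -
  have "norm Q \<le> (\<Sum>i\<in>(UNIV :: 'n set). 1)" if "orthogonal_matrix Q" for Q :: "real ^ 'n ^ 'n"
  proof -
    have "norm (Q $ i) = 1" for i
      using that by (simp add: orthogonal_matrix_orthonormal_rows row_def vec_lambda_eta)
    then show ?thesis
      unfolding norm_vec_def by (intro order_trans[OF L2_set_le_sum]) auto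
  qed
  then have "bounded {Q :: real ^ 'n ^ 'n. orthogonal_matrix Q}"
    unfolding bounded_iff by blast
  moreover have "closed {Q :: real ^ 'n ^ 'n. orthogonal_matrix Q}"
  proof -
    have "{Q :: real ^ 'n ^ 'n. orthogonal_matrix Q} =
      (\<Inter>i. \<Inter>j. {Q. (\<Sum>k\<in>UNIV. Q $ k $ i * Q $ k $ j) = (mat 1 :: real ^ 'n ^ 'n) $ i $ j})"
      by (auto simp: orthogonal_matrix vec_eq_iff matrix_matrix_mult_def transpose_def)
    also have "closed \<dots>"
      by (intro closed_INT ballI closed_Collect_eq continuous_intros)
    finally show ?thesis .
  qed
  ultimately show ?thesis by (simp add: compact_eq_bounded_closed)
qed

section \<open>Singular value decomposition\<close>

lemma diagonal_matrix_mult_left: "(diagonal_matrix s ** P) $ i $ j = s i * P $ i $ j"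
  by (simp add: diagonal_matrix_def matrix_matrix_mult_def if_distrib[of "\<lambda>c. c * _"] cong: if_cong)

lemma diagonal_matrix_mult_right: "(P ** diagonal_matrix s) $ i $ j = P $ i $ j * s j"
  by (simp add: diagonal_matrix_def matrix_matrix_mult_def if_distrib[of "\<lambda>c. _ * c"] cong: if_cong)

text \<open>The pair \<open>(U, V)\<close> maximises von Neumann's trace functional with pairwise distinct positive
  weights; the first-order conditions in \<open>U\<close> and in \<open>V\<close> together force \<open>U M V\<close> to be diagonal.\<close>

theorem singular_value_decomposition:
  fixes M :: "real ^ 'n ^ 'n"
  obtains U V s where "orthogonal_matrix U" "orthogonal_matrix V" "\<And>i. 0 \<le> s i"
    "U ** M ** V = diagonal_matrix s"
proof -
  obtain h :: "'n \<Rightarrow> nat" where h: "inj h"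
    using finite_imp_inj_to_nat_seg[of "UNIV :: 'n set"] by auto
  \<comment> \<open>An injective numbering of the indices, shifted by one so that all weights are
    positive; their squares are then pairwise distinct.\<close>
  define w where "w i = real (Suc (h i))" for i
  have w_pos: "0 < w i" for i by (simp add: w_def)
  have w_inj: "(w i)\<^sup>2 \<noteq> (w j)\<^sup>2" if "i \<noteq> j" for i j
    using that h w_pos[of i] w_pos[of j] by (auto simp: w_def power2_eq_iff inj_def)
  define D where "D = diagonal_matrix w"
  let ?O = "{Q :: real ^ 'n ^ 'n. orthogonal_matrix Q}"
  let ?f = "\<lambda>(U, V). trace (D ** U ** M ** V)"
  have "continuous_on (?O \<times> ?O) ?f"
    unfolding trace_def matrix_matrix_mult_def case_prod_unfold vec_lambda_beta
    by (intro continuous_intros)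
  moreover have "compact (?O \<times> ?O)"
    by (intro compact_Times compact_orthogonal_matrices)
  moreover have "?O \<times> ?O \<noteq> {}"
    using orthogonal_matrix_id by blast
  ultimately obtain UV where "UV \<in> ?O \<times> ?O" and max': "\<And>XY. XY \<in> ?O \<times> ?O \<Longrightarrow> ?f XY \<le> ?f UV"
    using continuous_attains_sup[of "?O \<times> ?O" ?f] by blast
  then obtain U V where UV: "orthogonal_matrix U" "orthogonal_matrix V"
    and max: "\<And>X Y. orthogonal_matrix X \<Longrightarrow> orthogonal_matrix Y \<Longrightarrow>
      trace (D ** X ** M ** Y) \<le> trace (D ** U ** M ** V)"
    using max'[of "(_, _)"] by (cases UV) auto
  define P where "P = U ** M ** V"
  \<comment> \<open>Varying \<open>U\<close> to \<open>X ** U\<close> and using cyclicity of the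
    trace shows that \<open>P ** D\<close> is trace-maximal; varying \<open>V\<close> to
    \<open>V ** X\<close> shows the same for \<open>D ** P\<close>.\<close>
  have left: "trace (X ** (P ** D)) \<le> trace (P ** D)" if "orthogonal_matrix X" for X
  proof -
    have "trace (X ** (P ** D)) = trace (D ** (X ** P))"
      by (subst trace_mul_sym[of D]) (simp add: matrix_mul_assoc)
    also have "\<dots> \<le> trace (D ** P)"
      using max[OF orthogonal_matrix_mul[OF that UV(1)] UV(2)]
      by (simp add: P_def matrix_mul_assoc)
    finally show ?thesis by (simp only: trace_mul_sym[of D P])
  qed
  have right: "trace (X ** (D ** P)) \<le> trace (D ** P)" if "orthogonal_matrix X" for X
  proof -
    have "trace (X ** (D ** P)) = trace (D ** P ** X)"
      by (subst trace_mul_sym) (simp add: matrix_mul_assoc)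
    also have "\<dots> \<le> trace (D ** P)"
      using max[OF UV(1) orthogonal_matrix_mul[OF UV(2) that]]
      by (simp add: P_def matrix_mul_assoc)
    finally show ?thesis .
  qed
  have off: "P $ i $ j = 0" if "i \<noteq> j" for i j
  proof -
    have 1: "P $ i $ j * w j = P $ j $ i * w i"
      using trace_maximal_imp_symmetric[OF left, of i j] by (simp add: D_def diagonal_matrix_mult_right)
    have 2: "w i * P $ i $ j = w j * P $ j $ i"
      using trace_maximal_imp_symmetric[OF right, of i j] by (simp add: D_def diagonal_matrix_mult_left)
    \<comment> \<open>Symmetry of \<open>P ** D\<close> and of \<open>D ** P\<close> gives two
      linear relations between the entries at \<open>(i, j)\<close> and \<open>(j, i)\<close>.
      Eliminating the second entry leaves a factor that is nonzero because the squared weights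
      differ.\<close>
    have "P $ i $ j * ((w i)\<^sup>2 - (w j)\<^sup>2) = w i * (w i * P $ i $ j) - w j * (P $ i $ j * w j)"
      by (simp add: power2_eq_square algebra_simps)
    also have "\<dots> = 0" by (simp add: 1 2)
    finally show ?thesis using w_inj[OF that] by simp
  qed
  have diag: "0 \<le> P $ i $ i" for i
  proof -
    have "axis i 1 \<bullet> ((D ** P) *v axis i 1) = w i * P $ i $ i"
      by (simp add: inner_axis' matrix_vector_mult_basis column_def D_def diagonal_matrix_mult_left)
    with trace_maximal_imp_psd[OF right, of "axis i 1"] w_pos[of i] show ?thesis
      by (simp add: zero_le_mult_iff)
  qed
  have "U ** M ** V = diagonal_matrix (\<lambda>i. P $ i $ i)"
    using off by (simp add: P_def[symmetric] diagonal_matrix_def vec_eq_iff)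
  with UV diag show ?thesis by (rule that)
qed

section \<open>Determinant gain at midpoints\<close>

lemma det_diagonal_matrix: "det (diagonal_matrix s) = (\<Prod>i\<in>UNIV. s i)"
  by (subst det_diagonal) (simp_all add: diagonal_matrix_def)

text \<open>The arithmetic-geometric mean inequality, factor by factor: the square of
  \<open>(s i + 1) / 2\<close> exceeds \<open>s i\<close> by the square of
  \<open>(s i - 1) / 2\<close>, strictly so at \<open>k\<close>. Multiplying up compares the squared
  product with \<open>1\<close>.\<close>

lemma prod_midpoint_one_gt_1:
  fixes s :: "'n::finite \<Rightarrow> real"
  assumes s: "\<And>i. 0 \<le> s i" and prod: "(\<Prod>i\<in>UNIV. s i) = 1" and k: "s k \<noteq> 1"
  shows "1 < (\<Prod>i\<in>UNIV. (s i + 1) / 2)"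
proof -
  have sq: "((s i + 1) / 2)\<^sup>2 = s i + ((s i - 1) / 2)\<^sup>2" for i
    by (simp add: power2_eq_square field_simps)
  have pos: "0 < s i" for i
    using s[of i] prod_zero[of UNIV s] prod by (cases "s i = 0") auto
  have "prod s UNIV < (\<Prod>i\<in>UNIV. ((s i + 1) / 2)\<^sup>2)"
  proof (rule prod_mono_strict[of k])
    show "s k < ((s k + 1) / 2)\<^sup>2" unfolding sq using k by simp
    show "0 \<le> s i \<and> s i \<le> ((s i + 1) / 2)\<^sup>2" for i unfolding sq using s by simp
    show "0 < ((s i + 1) / 2)\<^sup>2" for i using pos[of i] by (intro zero_less_power) simp
  qed simp_all
  then have "1\<^sup>2 < (\<Prod>i\<in>UNIV. (s i + 1) / 2)\<^sup>2"
    by (simp add: prod prod_power_distrib)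
  then show ?thesis
    by (rule power2_less_imp_less) (intro prod_nonneg ballI; use s in simp)
qed

lemma norm_orthogonal_matrix_mult: "orthogonal_matrix Q \<Longrightarrow> norm (Q *v (x :: real ^ 'n)) = norm x"
  using orthogonal_transformation_matrix[of "(*v) Q"] by (simp add: orthogonal_transformation_norm)

lemma abs_det_orthogonal: "orthogonal_matrix (Q :: real ^ 'n ^ 'n) \<Longrightarrow> \<bar>det Q\<bar> = 1"
  using det_orthogonal_matrix by fastforce

lemma matrix_add_rdistrib: "(A + B) ** C = A ** C + B ** (C :: real ^ 'n ^ 'm)"
  by (simp add: vec_eq_iff matrix_matrix_mult_def sum.distrib distrib_right)

text \<open>With \<open>M\<close> standing for \<open>A\<close> times the inverse of
  \<open>B\<close>, and \<open>U ** M ** V\<close> diagonal, the choice \<open>Q = V ** U\<close>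
  turns \<open>Q ** M\<close> into the positive semidefinite matrix
  \<open>V ** diagonal_matrix s ** transpose V\<close>. The midpoint with \<open>B\<close> then has
  singular factors \<open>(s i + 1) / 2\<close>, and the singular values \<open>s i\<close> have
  product \<open>1\<close>.\<close>

lemma abs_det_midpoint_gt:
  fixes A B :: "real ^ 'n ^ 'n"
  assumes B: "invertible B" and det: "\<bar>det A\<bar> = \<bar>det B\<bar>"
    and ne: "norm (A *v x) \<noteq> norm (B *v x)"
  obtains Q where "orthogonal_matrix Q" "\<bar>det B\<bar> < \<bar>det ((1/2) *\<^sub>R (Q ** A + B))\<bar>"
proof -
  obtain B' where B': "B ** B' = mat 1" "B' ** B = mat 1"
    using B by (auto simp: invertible_def)
  define M where "M = A ** B'"
  have MB: "M ** B = A"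
    by (simp add: M_def matrix_mul_assoc[symmetric] B')
  obtain U V s where U: "orthogonal_matrix U" and V: "orthogonal_matrix V" and s: "\<And>i. 0 \<le> s i"
    and svd: "U ** M ** V = diagonal_matrix s"
    using singular_value_decomposition[of M] by blast
  have VV: "V ** transpose V = mat 1" using V by (simp add: orthogonal_matrix_def)
  have detB: "det B \<noteq> 0" using B by (simp add: invertible_det_nz)
  have "\<bar>det M\<bar> * \<bar>det B\<bar> = \<bar>det B\<bar>"
    using det MB by (metis abs_mult det_mul)
  then have "\<bar>det M\<bar> = 1" using detB by simp
  then have "\<bar>det (diagonal_matrix s)\<bar> = 1"
    by (simp add: svd[symmetric] det_mul abs_mult abs_det_orthogonal U V)
  then have prod: "(\<Prod>i\<in>UNIV. s i) = 1"
    using prod_nonneg[of UNIV s] s by (simp add: det_diagonal_matrix)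
  \<comment> \<open>If all singular values were \<open>1\<close>, then \<open>M\<close> would be
    orthogonal and \<open>A\<close>, \<open>B\<close> would give every vector the same norm,
    contrary to \<open>ne\<close>.\<close>
  have "\<exists>k. s k \<noteq> 1"
  proof (rule ccontr)
    assume "\<nexists>k. s k \<noteq> 1"
    then have "diagonal_matrix s = mat 1"
      by (simp add: diagonal_matrix_def mat_def vec_eq_iff)
    then have UMV: "U ** M ** V = mat 1" using svd by simp
    have "U ** M = (U ** M ** V) ** transpose V"
      by (simp add: matrix_mul_assoc[symmetric] VV)
    then have "U ** M = transpose V" using UMV by simp
    then have "U ** A = transpose V ** B"
      using MB by (metis matrix_mul_assoc)
    then have "norm (U *v (A *v x)) = norm (transpose V *v (B *v x))"
      by (simp add: matrix_vector_mul_assoc)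
    then have "norm (A *v x) = norm (B *v x)"
      using U V by (metis norm_orthogonal_matrix_mult orthogonal_matrix_transpose)
    with ne show False by simp
  qed
  then obtain k where k: "s k \<noteq> 1" by blast
  define T where "T = diagonal_matrix (\<lambda>i. (s i + 1) / 2)"
  have T: "T = (1/2) *\<^sub>R (diagonal_matrix s + mat 1)"
    by (simp add: T_def diagonal_matrix_def mat_def vec_eq_iff)
  have "V ** U ** M = V ** (U ** M ** V) ** transpose V"
    by (simp add: matrix_mul_assoc[symmetric] VV)
  then have VUA: "V ** U ** A = V ** diagonal_matrix s ** transpose V ** B"
    by (simp add: svd MB[symmetric] matrix_mul_assoc)
  have "V ** T ** transpose V ** B = (1/2) *\<^sub>R (V ** U ** A + V ** transpose V ** B)"
    unfolding VUA T
    by (simp add: matrix_add_ldistrib matrix_add_rdistrib scalar_matrix_assoc matrix_scalar_ac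
        scaleR_add_right)
  then have "V ** T ** transpose V ** B = (1/2) *\<^sub>R (V ** U ** A + B)"
    by (simp add: VV)
  then have "\<bar>det ((1/2) *\<^sub>R (V ** U ** A + B))\<bar> = \<bar>det (V ** T ** transpose V ** B)\<bar>"
    by (simp only:)
  also have "\<dots> = \<bar>det T\<bar> * \<bar>det B\<bar>"
    by (simp add: det_mul abs_mult abs_det_orthogonal V)
  finally have "\<bar>det ((1/2) *\<^sub>R (V ** U ** A + B))\<bar> = \<bar>det T\<bar> * \<bar>det B\<bar>" .
  moreover have "1 < \<bar>det T\<bar>"
    using prod_midpoint_one_gt_1[OF s prod k] by (simp add: T_def det_diagonal_matrix)
  ultimately have "\<bar>det B\<bar> < \<bar>det ((1/2) *\<^sub>R (V ** U ** A + B))\<bar>" using detB by simp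
  with orthogonal_matrix_mul[OF V U] show ?thesis by (rule that)
qed

subsection \<open>Spherical measure\<close>

lemma norm_matrix_vector_mult_le:
  fixes A :: "real ^ 'n ^ 'm"
  shows "norm (A *v x) \<le> norm A * norm x"
proof -
  have "norm (A *v x) \<le> L2_set (\<lambda>i. norm (A $ i) * norm x) UNIV"
    unfolding norm_vec_def[of "A *v x"]
    by (intro L2_set_mono) (simp_all add: matrix_vector_mul_component Cauchy_Schwarz_ineq2)
  also have "\<dots> = norm A * norm x"
    by (simp add: norm_vec_def[of A] L2_set_left_distrib)
  finally show ?thesis .
qed

lemma abs_norm_matrix_vector_diff_le:
  fixes A B :: "real ^ 'n ^ 'm"
  assumes "norm u = 1"
  shows "\<bar>norm (A *v u) - norm (B *v u)\<bar> \<le> norm (A - B)"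
proof -
  have "\<bar>norm (A *v u) - norm (B *v u)\<bar> \<le> norm ((A - B) *v u)"
    by (simp add: matrix_vector_mult_diff_rdistrib norm_triangle_ineq3)
  also have "\<dots> \<le> norm (A - B)"
    using norm_matrix_vector_mult_le[of "A - B" u] assms by simp
  finally show ?thesis .
qed

lemma continuous_on_matrix_vector_mult [continuous_intros]:
  fixes A :: "'a :: topological_space \<Rightarrow> real ^ 'n ^ 'm"
  assumes "continuous_on S A" "continuous_on S f"
  shows "continuous_on S (\<lambda>x. A x *v f x)"
  unfolding matrix_vector_mult_def by (intro continuous_intros assms)

lemma space_sphere_measure [simp]: "space (sphere_measure :: (real ^ 'n) measure) = sphere 0 1"
  by (simp add: sphere_measure_def space_restrict_space)

lemma sets_sphere_measure [measurable_cong]: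
  "sets (sphere_measure :: (real ^ 'n) measure) = sets (restrict_space borel (sphere 0 1))"
  by (simp add: sphere_measure_def)

lemma finite_measure_sphere_measure: "finite_measure (sphere_measure :: (real ^ 'n) measure)"
proof
  let ?C = "{r *\<^sub>R u | r u. 0 < r \<and> r \<le> 1 \<and> u \<in> sphere 0 1} :: (real ^ 'n) set"
  have "?C \<subseteq> cball 0 1" by auto
  then have "emeasure lborel ?C \<le> emeasure lborel (cball (0 :: real ^ 'n) 1)"
    by (rule emeasure_mono) auto
  also have "\<dots> < \<infinity>" by (rule emeasure_lborel_cball_finite)
  finally have "emeasure lborel ?C < \<infinity>" .
  then show "emeasure sphere_measure (space sphere_measure :: (real ^ 'n) set) \<noteq> \<infinity>"
    by (simp add: emeasure_sphere_measure ennreal_mult_eq_top_iff less_top)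
qed

interpretation sphere_measure: finite_measure "sphere_measure :: (real ^ 'n) measure"
  by (rule finite_measure_sphere_measure)

lemma borel_measurable_sphere_measure:
  fixes f :: "real ^ 'n \<Rightarrow> real"
  assumes "continuous_on (sphere 0 1) f"
  shows "f \<in> borel_measurable sphere_measure"
  using borel_measurable_continuous_on_restrict[OF assms]
    measurable_cong_sets[OF sets_sphere_measure refl] by blast

lemma integrable_sphere_measure:
  fixes f :: "real ^ 'n \<Rightarrow> real"
  assumes "continuous_on (sphere 0 1) f"
  shows "integrable sphere_measure f"
proof -
  have "bounded (f ` sphere 0 1)"
    by (intro compact_imp_bounded compact_continuous_image assms) simp
  then obtain c where "\<forall>u\<in>sphere 0 1. norm (f u) \<le> c"
    by (auto simp: bounded_iff)
  then show ?thesis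
    by (intro sphere_measure.integrable_const_bound[of _ c] AE_I2
        borel_measurable_sphere_measure assms) auto
qed

lemma emeasure_lborel_hyperplane:
  fixes a :: "real ^ 'n"
  assumes "a \<noteq> 0"
  shows "emeasure lborel {x. a \<bullet> x = 0} = 0"
proof -
  have "emeasure lebesgue {x. a \<bullet> x = 0} = 0"
    using negligible_hyperplane[of a 0] assms by (simp add: negligible_iff_emeasure0 closed_hyperplane)
  then show ?thesis
    by (simp add: closed_hyperplane borel_closed)
qed

text \<open>If the integral vanished, \<open>B\<close> would kill almost every direction. Passing to
  the cone over the exceptional directions, the unit ball would lie, up to a null set, in the
  hyperplane orthogonal to a nonzero row of \<open>B\<close>.\<close>

lemma integral_norm_matrix_pos:
  fixes B :: "real ^ 'n ^ 'n"
  assumes "B \<noteq> 0"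
  shows "0 < (\<integral>u. norm (B *v u) \<partial>sphere_measure)"
proof -
  have int: "integrable sphere_measure (\<lambda>u. norm (B *v u))"
    by (intro integrable_sphere_measure continuous_intros)
  obtain i where i: "B $ i \<noteq> 0" using assms by (metis vec_eq_iff zero_index)
  have "(\<integral>u. norm (B *v u) \<partial>sphere_measure) \<noteq> 0"
  proof
    assume "(\<integral>u. norm (B *v u) \<partial>sphere_measure) = 0"
    then have ae: "AE u in sphere_measure. norm (B *v u) = 0"
      using integral_nonneg_eq_0_iff_AE[OF int] by simp
    let ?A = "{u \<in> sphere 0 1. B *v u \<noteq> 0}"
    have A: "?A \<in> sets borel"
    proof -
      have "open {u. B *v u \<noteq> 0}" by (intro open_Collect_neq continuous_intros)
      then have "sphere 0 1 \<inter> {u. B *v u \<noteq> 0} \<in> sets borel" by auto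
      moreover have "?A = sphere 0 1 \<inter> {u. B *v u \<noteq> 0}" by auto
      ultimately show ?thesis by simp
    qed
    have sub: "?A \<subseteq> sphere 0 1" by auto
    from A have "?A \<in> sets sphere_measure"
      by (auto simp: sets_sphere_measure sets_restrict_space_iff)
    then have "emeasure sphere_measure ?A = 0"
      using ae by (subst (asm) AE_iff_measurable[where N = ?A]) auto
    then have cone: "emeasure lborel {r *\<^sub>R u | r u. 0 < r \<and> r \<le> 1 \<and> u \<in> ?A} = 0"
      using emeasure_sphere_measure[OF A sub] by auto
    let ?C = "cball 0 1 \<inter> {x. B *v x \<noteq> 0}"
    have "{r *\<^sub>R u | r u. 0 < r \<and> r \<le> 1 \<and> u \<in> ?A} = ?C"
    proof (intro set_eqI iffI)
      fix x assume x: "x \<in> ?C"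
      then have "x \<noteq> 0" by auto
      then have "x = norm x *\<^sub>R (x /\<^sub>R norm x)" "0 < norm x" "norm x \<le> 1" "x /\<^sub>R norm x \<in> ?A"
        using x by (auto simp: matrix_vector_mult_scaleR)
      then show "x \<in> {r *\<^sub>R u | r u. 0 < r \<and> r \<le> 1 \<and> u \<in> ?A}" by blast
    qed (auto simp: matrix_vector_mult_scaleR)
    with cone have "emeasure lborel ?C = 0" by simp
    moreover have "open {x. B *v x \<noteq> 0}" by (intro open_Collect_neq continuous_intros)
    then have C: "?C \<in> sets lborel" by auto
    moreover have H: "{x. B $ i \<bullet> x = 0} \<in> sets lborel" by (simp add: closed_hyperplane borel_closed)
    moreover have "emeasure lborel {x. B $ i \<bullet> x = 0} = 0"
      using emeasure_lborel_hyperplane[OF i] .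
    ultimately have "emeasure lborel (?C \<union> {x. B $ i \<bullet> x = 0}) = 0"
      by (subst emeasure_Un_null_set) (auto simp: null_sets_def)
    moreover have "cball 0 1 \<subseteq> ?C \<union> {x. B $ i \<bullet> x = 0}"
      by (auto simp: vec_eq_iff matrix_vector_mul_component)
    then have "emeasure lborel (cball (0 :: real ^ 'n) 1) \<le> emeasure lborel (?C \<union> {x. B $ i \<bullet> x = 0})"
      by (rule emeasure_mono) (use C H in auto)
    ultimately have "measure lborel (cball (0 :: real ^ 'n) 1) = 0"
      by (simp add: measure_def)
    then show False
      using content_cball_pos[of 1 "0 :: real ^ 'n"] by simp
  qed
  moreover have "0 \<le> (\<integral>u. norm (B *v u) \<partial>sphere_measure)" by simp
  ultimately show ?thesis by linarith
qed

text \<open>The integral is Lipschitz and positively homogeneous in \<open>B\<close>, so its minimum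
  over the compact unit sphere of matrices serves as \<open>c\<close>. This equivalence with the
  matrix norm is what later turns an energy bound into a bound on \<open>B\<close>.\<close>

lemma integral_norm_matrix_ge:
  obtains c where "0 < c"
    "\<And>B :: real ^ 'n ^ 'n. c * norm B \<le> (\<integral>u. norm (B *v u) \<partial>sphere_measure)"
proof -
  let ?G = "\<lambda>B :: real ^ 'n ^ 'n. \<integral>u. norm (B *v u) \<partial>sphere_measure"
  let ?s = "measure sphere_measure (sphere 0 1 :: (real ^ 'n) set)"
  have int: "integrable sphere_measure (\<lambda>u. norm (B *v u))" for B :: "real ^ 'n ^ 'n"
    by (intro integrable_sphere_measure continuous_intros)
  have le: "?G A - ?G B \<le> ?s * norm (A - B)" for A B
  proof -
    have "?G A - ?G B = (\<integral>u. norm (A *v u) - norm (B *v u) \<partial>sphere_measure)"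
      using int by simp
    also have "\<dots> \<le> (\<integral>u. norm (A - B) \<partial>(sphere_measure :: (real ^ 'n) measure))"
      using abs_norm_matrix_vector_diff_le[of _ A B]
      by (intro integral_mono Bochner_Integration.integrable_diff int) fastforce+
    finally show ?thesis by (simp add: mult.commute)
  qed
  have "?s-lipschitz_on UNIV ?G"
  proof (rule lipschitz_onI)
    show "dist (?G A) (?G B) \<le> ?s * dist A B" for A B
      using le[of A B] le[of B A] by (simp add: dist_norm norm_minus_commute abs_le_iff)
  qed simp
  then have cont: "continuous_on (sphere 0 1) ?G"
    using lipschitz_on_continuous_on continuous_on_subset by blast
  have "sphere (0 :: real ^ 'n ^ 'n) 1 \<noteq> {}" by simp
  with continuous_attains_inf[OF compact_sphere _ cont] obtain B0
    where B0: "B0 \<in> sphere 0 1" and min: "\<And>B. B \<in> sphere 0 1 \<Longrightarrow> ?G B0 \<le> ?G B" by auto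
  show ?thesis
  proof (rule that)
    show "0 < ?G B0" using B0 by (intro integral_norm_matrix_pos) auto
    fix B :: "real ^ 'n ^ 'n"
    show "?G B0 * norm B \<le> ?G B"
    proof (cases "B = 0")
      case False
      have "?G B0 \<le> ?G (B /\<^sub>R norm B)" using False by (intro min) simp
      also have "?G (B /\<^sub>R norm B) = ?G B / norm B"
        by (simp add: scaleR_matrix_vector_assoc[symmetric] divide_inverse mult.commute)
      finally show ?thesis using False by (simp add: field_simps)
    qed simp
  qed
qed

subsection \<open>Linear images and volume\<close>

lemma measure_shear_cbox:
  fixes a b :: "real ^ 'n"
  assumes "m \<noteq> n"
  defines "h \<equiv> \<lambda>x :: real ^ 'n. \<chi> i. if i = m then x $ m + x $ n else x $ i"
  shows "measure lebesgue (h ` cbox a b) = measure lebesgue (cbox a b)"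
proof (cases "cbox a b = {}")
  case False
  \<comment> \<open>This translation moves the \<open>n\<close>-th lower bound to \<open>0\<close>,
    which meets the sign condition of \<open>measure_shear_interval\<close>; translations leave both
    measures unchanged.\<close>
  define t where "t = axis n (- a $ n)"
  have "linear h"
    unfolding h_def by (rule linearI) (auto simp: vec_eq_iff algebra_simps)
  then have "h ` (+) t ` cbox a b = (+) (h t) ` h ` cbox a b"
    by (simp add: image_image linear_add)
  then have "measure lebesgue (h ` cbox a b) = measure lebesgue (h ` cbox (t + a) (t + b))"
    by (simp add: cbox_translation measure_translation)
  also have "\<dots> = measure lebesgue (cbox (t + a) (t + b))"
    unfolding h_def
    by (rule measure_shear_interval[OF assms(1)]) (use False in \<open>simp_all add: cbox_translation t_def\<close>)
  also have "\<dots> = measure lebesgue (cbox a b)"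
    by (simp add: cbox_translation measure_translation)
  finally show ?thesis .
qed simp

lemma measure_swap_cbox:
  fixes a b :: "real ^ 'n" and m n :: 'n
  defines "h \<equiv> \<lambda>x :: real ^ 'n. \<chi> i. x $ Transposition.transpose m n i"
  shows "measure lebesgue (h ` cbox a b) = measure lebesgue (cbox a b)"
proof -
  have hh: "h (h x) = x" for x by (simp add: h_def vec_eq_iff)
  have le: "h x \<in> cbox (h a) (h b) \<longleftrightarrow> x \<in> cbox a b" for x
    unfolding h_def mem_box_cart by (simp add: h_def) (metis transpose_involutory)
  have "h ` cbox a b = cbox (h a) (h b)"
  proof (intro set_eqI iffI)
    fix y assume "y \<in> cbox (h a) (h b)"
    then show "y \<in> h ` cbox a b"
      using le[of "h y"] hh[of y] by (metis image_eqI)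
  qed (use le in auto)
  moreover have "(\<Prod>i\<in>UNIV. h b $ i - h a $ i) = (\<Prod>i\<in>UNIV. b $ i - a $ i)"
    unfolding h_def vec_lambda_beta
    using prod.permute[OF permutes_swap_id[of m UNIV n], of "\<lambda>i. b $ i - a $ i"] by simp
  moreover have "cbox (h a) (h b) = {} \<longleftrightarrow> cbox a b = {}"
    using calculation(1) by (metis image_is_empty)
  ultimately show ?thesis
    by (simp add: content_cbox_if_cart)
qed

text \<open>The library computes the measure of a linear image only over well-ordered index types
  (\<open>measure_linear_image\<close>). Over an arbitrary finite index type, a linear map scales the measure by
  some factor, which must be \<open>1\<close> for an orthogonal one because it preserves the ball; the general
  factor is then read off the singular value decomposition.\<close>

definition scales_measure :: "(real ^ 'n \<Rightarrow> real ^ 'n) \<Rightarrow> real \<Rightarrow> bool" where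
  "scales_measure f c \<longleftrightarrow>
     (\<forall>S\<in>lmeasurable. f ` S \<in> lmeasurable \<and> measure lebesgue (f ` S) = c * measure lebesgue S)"

lemma scales_measure_oneI:
  fixes f :: "real ^ 'n \<Rightarrow> real ^ 'n"
  assumes "linear f" "\<And>a b. measure lebesgue (f ` cbox a b) = measure lebesgue (cbox a b)"
  shows "scales_measure f 1"
  unfolding scales_measure_def
proof
  fix S :: "(real ^ 'n) set" assume "S \<in> lmeasurable"
  then have *: "f ` S \<in> lmeasurable \<and> 1 * measure lebesgue S = measure lebesgue (f ` S)"
    using assms by (intro measure_linear_sufficient) simp_all
  show "f ` S \<in> lmeasurable \<and> measure lebesgue (f ` S) = 1 * measure lebesgue S"
    by (rule conjI[OF conjunct1[OF *] conjunct2[OF *, symmetric]])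
qed

lemma scales_measure_comp:
  fixes f g :: "real ^ 'n \<Rightarrow> real ^ 'n"
  assumes f: "scales_measure f c" and g: "scales_measure g d"
  shows "scales_measure (f \<circ> g) (c * d)"
  unfolding scales_measure_def
proof
  fix S :: "(real ^ 'n) set" assume S: "S \<in> lmeasurable"
  note g' = bspec[OF g[unfolded scales_measure_def] S]
  note f' = bspec[OF f[unfolded scales_measure_def] conjunct1[OF g']]
  have "(f \<circ> g) ` S = f ` g ` S" by (simp only: image_comp)
  moreover have "c * measure lebesgue (g ` S) = (c * d) * measure lebesgue S"
    using conjunct2[OF g'] by simp
  ultimately show "(f \<circ> g) ` S \<in> lmeasurable \<and>
      measure lebesgue ((f \<circ> g) ` S) = (c * d) * measure lebesgue S"
    using f' by (simp only:)
qed

text \<open>Induction over elementary maps. A map with a vanishing coordinate has negligible images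
  and factor \<open>0\<close>; a stretch has the absolute product of its coefficients; swaps and
  shears have factor \<open>1\<close>. Only the existence of a factor is kept, so the composition
  step is immediate.\<close>

lemma linear_image_scales_measure:
  fixes f :: "real ^ 'n \<Rightarrow> real ^ 'n"
  assumes "linear f"
  shows "\<exists>c. scales_measure f c"
proof (rule induct_linear_elementary[where P = "\<lambda>f. \<exists>c. scales_measure f c", OF assms])
  fix f g :: "real ^ 'n \<Rightarrow> real ^ 'n"
  assume "\<exists>c. scales_measure f c" "\<exists>c. scales_measure g c"
  then show "\<exists>c. scales_measure (f \<circ> g) c" by (meson scales_measure_comp)
next
  fix f :: "real ^ 'n \<Rightarrow> real ^ 'n" and i
  assume f: "linear f" "\<And>x. f x $ i = 0"
  have "\<not> inj f"
  proof
    assume "inj f"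
    then obtain x where "f x = axis i 1"
      using linear_injective_imp_surjective[OF f(1)] by (metis surjE)
    with f(2)[of x] show False by simp
  qed
  with f(1) have "negligible (f ` S)" for S
    by (rule negligible_linear_singular_image)
  then show "\<exists>c. scales_measure f c"
    by (intro exI[of _ 0]) (simp add: scales_measure_def negligible_iff_measure)
next
  fix c :: "'n \<Rightarrow> real"
  show "\<exists>d. scales_measure (\<lambda>x. \<chi> i. c i * x $ i) d"
    by (intro exI[of _ "\<bar>prod c UNIV\<bar>"])
      (simp add: scales_measure_def measurable_stretch measure_stretch)
next
  fix m n :: 'n
  have "linear (\<lambda>x :: real ^ 'n. \<chi> i. x $ Transposition.transpose m n i)"
    by (rule linearI) (simp_all add: vec_eq_iff)
  from scales_measure_oneI[OF this measure_swap_cbox]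
  show "\<exists>c. scales_measure (\<lambda>x. \<chi> i. x $ Transposition.transpose m n i) c" ..
next
  fix m n :: 'n
  assume mn: "m \<noteq> n"
  have "linear (\<lambda>x :: real ^ 'n. \<chi> i. if i = m then x $ m + x $ n else x $ i)"
    by (rule linearI) (auto simp: vec_eq_iff algebra_simps)
  from scales_measure_oneI[OF this measure_shear_cbox[OF mn]]
  show "\<exists>c. scales_measure (\<lambda>x. \<chi> i. if i = m then x $ m + x $ n else x $ i) c" ..
qed

lemma orthogonal_matrix_image_ball:
  fixes Q :: "real ^ 'n ^ 'n"
  assumes Q: "orthogonal_matrix Q"
  shows "(*v) Q ` cball 0 1 = cball 0 1"
proof (intro set_eqI iffI)
  fix y :: "real ^ 'n" assume y: "y \<in> cball 0 1"
  have "y = Q *v (transpose Q *v y)"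
    using Q by (simp add: matrix_vector_mul_assoc orthogonal_matrix_def del: transpose_matrix_vector)
  moreover have "transpose Q *v y \<in> cball 0 1"
    using y norm_orthogonal_matrix_mult[of "transpose Q" y] Q
    by (simp del: transpose_matrix_vector)
  ultimately show "y \<in> (*v) Q ` cball 0 1" by blast
qed (auto simp: norm_orthogonal_matrix_mult Q)

lemma measure_orthogonal_matrix_image:
  fixes Q :: "real ^ 'n ^ 'n"
  assumes Q: "orthogonal_matrix Q" and S: "S \<in> lmeasurable"
  shows "(*v) Q ` S \<in> lmeasurable" "measure lebesgue ((*v) Q ` S) = measure lebesgue S"
proof -
  obtain c where c: "\<And>S. S \<in> lmeasurable \<Longrightarrow> (*v) Q ` S \<in> lmeasurable \<and>
      measure lebesgue ((*v) Q ` S) = c * measure lebesgue S"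
    using linear_image_scales_measure[of "(*v) Q"] by (auto simp: scales_measure_def)
  have "measure lebesgue (cball (0 :: real ^ 'n) 1) = c * measure lebesgue (cball (0 :: real ^ 'n) 1)"
    using c[of "cball 0 1"] orthogonal_matrix_image_ball[OF Q] by simp
  then have "c = 1" using content_cball_pos[of 1 "0 :: real ^ 'n"] by simp
  with c[OF S] show "(*v) Q ` S \<in> lmeasurable" "measure lebesgue ((*v) Q ` S) = measure lebesgue S"
    by auto
qed

lemma measure_matrix_image:
  fixes A :: "real ^ 'n ^ 'n"
  assumes S: "S \<in> lmeasurable"
  shows "measure lebesgue ((*v) A ` S) = \<bar>det A\<bar> * measure lebesgue S"
proof -
  obtain U V s where U: "orthogonal_matrix U" and V: "orthogonal_matrix V" and "\<And>i. 0 \<le> s i"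
    and svd: "U ** A ** V = diagonal_matrix s"
    using singular_value_decomposition[of A] by blast
  have D: "(*v) (diagonal_matrix s) = (\<lambda>x. \<chi> i. s i * x $ i)"
    by (auto simp: fun_eq_iff vec_eq_iff diagonal_matrix_def matrix_vector_mult_def
        if_distrib[of "\<lambda>c. c * _"] cong: if_cong)
  have VS: "(*v) (transpose V) ` S \<in> lmeasurable"
    "measure lebesgue ((*v) (transpose V) ` S) = measure lebesgue S"
    using measure_orthogonal_matrix_image[of "transpose V" S] V S by auto
  \<comment> \<open>The map \<open>U A\<close> is the coordinate stretch after
    \<open>transpose V\<close>; both orthogonal maps preserve measure, so the stretch alone decides
    the factor.\<close>
  have "(*v) U ` (*v) A ` S = (*v) (U ** A ** V) ` (*v) (transpose V) ` S"
  proof -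
    have "U ** A = U ** A ** V ** transpose V"
      using V by (simp add: orthogonal_matrix_def matrix_mul_assoc[symmetric])
    then show ?thesis
      by (simp add: image_image matrix_vector_mul_assoc del: transpose_matrix_vector)
  qed
  then have "measure lebesgue ((*v) U ` (*v) A ` S) = \<bar>\<Prod>i\<in>UNIV. s i\<bar> * measure lebesgue S"
    using measure_stretch[OF VS(1), of s] VS(2) by (simp add: svd D)
  moreover have "(*v) A ` S \<in> lmeasurable"
    using linear_image_scales_measure[of "(*v) A"] S by (auto simp: scales_measure_def)
  then have "measure lebesgue ((*v) U ` (*v) A ` S) = measure lebesgue ((*v) A ` S)"
    by (intro measure_orthogonal_matrix_image(2)[OF U])
  moreover have "\<bar>\<Prod>i\<in>UNIV. s i\<bar> = \<bar>det A\<bar>"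
    by (simp add: det_diagonal_matrix[symmetric] svd[symmetric] det_mul abs_mult abs_det_orthogonal U V)
  ultimately show ?thesis by simp
qed

subsection \<open>Star bodies\<close>

context
  fixes K :: "(real ^ 'n) set"
  assumes K: "star_body K"
begin

text \<open>Compactness makes the supremum in \<open>radial\<close> attained, and star-shapedness
  fills the segment below it.\<close>

lemma star_body_ray:
  assumes u: "u \<in> sphere 0 1" and c: "0 \<le> c"
  shows "c *\<^sub>R u \<in> K \<longleftrightarrow> c \<le> radial K u"
proof -
  let ?C = "{c. 0 \<le> c \<and> c *\<^sub>R u \<in> K}"
  have "compact K" and shrink: "\<And>x t. x \<in> K \<Longrightarrow> t \<in> {0..1} \<Longrightarrow> t *\<^sub>R x \<in> K"
    and "0 \<in> interior K"
    using K by (auto simp: star_body_def)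
  then have "0 \<in> K" using interior_subset by blast
  obtain R where R: "\<And>x. x \<in> K \<Longrightarrow> norm x \<le> R"
    using \<open>compact K\<close> compact_imp_bounded bounded_iff by metis
  have bdd: "bdd_above ?C"
  proof (rule bdd_aboveI)
    fix t assume "t \<in> ?C" then show "t \<le> R" using R[of "t *\<^sub>R u"] u by auto
  qed
  have "closed ((\<lambda>t. t *\<^sub>R u) -` K)"
    using \<open>compact K\<close> by (intro closed_vimage compact_imp_closed continuous_intros)
  then have "closed ({0..} \<inter> (\<lambda>t. t *\<^sub>R u) -` K)" by (intro closed_Int closed_atLeast)
  moreover have "{0..} \<inter> (\<lambda>t. t *\<^sub>R u) -` K = ?C" by auto
  ultimately have "closed ?C" by simp
  then have "Sup ?C \<in> ?C"
    using bdd \<open>0 \<in> K\<close> by (intro closed_contains_Sup) auto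
  then have top: "0 \<le> radial K u" "radial K u *\<^sub>R u \<in> K" by (auto simp: radial_def)
  show ?thesis
  proof
    assume "c *\<^sub>R u \<in> K"
    then show "c \<le> radial K u" unfolding radial_def using bdd c by (intro cSup_upper) auto
  next
    assume le: "c \<le> radial K u"
    show "c *\<^sub>R u \<in> K"
    proof (cases "radial K u = 0")
      case True with le c \<open>0 \<in> K\<close> show ?thesis by simp
    next
      case False
      then have "c / radial K u \<in> {0..1}" using top(1) le c by simp
      from shrink[OF top(2) this] False show ?thesis by simp
    qed
  qed
qed

lemma star_body_mem_iff:
  assumes "x \<noteq> 0"
  shows "x \<in> K \<longleftrightarrow> norm x \<le> radial K (x /\<^sub>R norm x)"
  using star_body_ray[of "x /\<^sub>R norm x" "norm x"] assms by simp

lemma star_body_zero_mem: "0 \<in> K"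
  using K interior_subset by (auto simp: star_body_def)

lemma continuous_on_radial: "continuous_on (sphere 0 1) (radial K)"
  using K by (simp add: star_body_def)

lemma radial_bounds:
  obtains r R where "0 < r" "\<And>u. u \<in> sphere 0 1 \<Longrightarrow> r \<le> radial K u"
    "\<And>u. u \<in> sphere 0 1 \<Longrightarrow> radial K u \<le> R"
proof -
  obtain r where r: "r > 0" "cball 0 r \<subseteq> K"
    using K mem_interior_cball[of 0 K] by (auto simp: star_body_def)
  have "bounded (radial K ` sphere 0 1)"
    by (intro compact_imp_bounded compact_continuous_image continuous_on_radial) simp
  then obtain R where R: "\<forall>u\<in>sphere 0 1. norm (radial K u) \<le> R" by (auto simp: bounded_iff)
  show ?thesis
  proof (rule that[OF r(1)])
    fix u :: "real ^ 'n" assume u: "u \<in> sphere 0 1"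
    then have "r *\<^sub>R u \<in> K" using r by auto
    then show "r \<le> radial K u" using star_body_ray[OF u] r(1) by simp
    show "radial K u \<le> R" using R u by force
  qed
qed

lemma radial_pos: "u \<in> sphere 0 1 \<Longrightarrow> 0 < radial K u"
  by (rule radial_bounds) (metis less_le_trans)

lemma star_body_lmeasurable: "K \<in> lmeasurable"
  using K by (intro lmeasurable_compact) (simp add: star_body_def)

lemma vol_pos: "0 < vol K"
proof -
  obtain r where r: "r > 0" "cball 0 r \<subseteq> K"
    using K mem_interior_cball[of 0 K] by (auto simp: star_body_def)
  have "0 < measure lebesgue (cball (0 :: real ^ 'n) r)"
    using r(1) content_cball_pos[of r "0 :: real ^ 'n"] by simp
  also have "\<dots> \<le> measure lebesgue K"
    using r(2) by (intro measure_mono_fmeasurable star_body_lmeasurable) auto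
  finally show ?thesis by (simp add: vol_def)
qed

end

text \<open>The pointwise comparison of radial functions says that \<open>K\<close> is contained in
  the dilate of \<open>L\<close> by \<open>t\<close>. Volumes are thereby compared without a
  polar-coordinate formula.\<close>

lemma vol_le_of_radial_le:
  fixes K L :: "(real ^ 'n) set"
  assumes K: "star_body K" and L: "star_body L" and t: "0 < t"
    and le: "\<And>u. u \<in> sphere 0 1 \<Longrightarrow> radial K u \<le> t * radial L u"
  shows "vol K \<le> t ^ CARD('n) * vol L"
proof -
  have "K \<subseteq> (*\<^sub>R) t ` L"
  proof
    fix x assume x: "x \<in> K"
    have "x /\<^sub>R t \<in> L"
    proof (cases "x = 0")
      case False
      then have "norm x \<le> t * radial L (x /\<^sub>R norm x)"
        using x star_body_mem_iff[OF K False] le[of "x /\<^sub>R norm x"] by simp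
      moreover have "(x /\<^sub>R t) /\<^sub>R norm (x /\<^sub>R t) = x /\<^sub>R norm x"
        using t by simp
      ultimately show ?thesis
        using t False by (subst star_body_mem_iff[OF L]) (auto simp: field_simps)
    qed (simp add: star_body_zero_mem[OF L])
    moreover have "x = t *\<^sub>R (x /\<^sub>R t)" using t by simp
    ultimately show "x \<in> (*\<^sub>R) t ` L" by (rule rev_image_eqI)
  qed
  moreover have "compact ((*\<^sub>R) t ` L)"
    using L by (intro compact_scaling) (simp add: star_body_def)
  ultimately have "measure lebesgue K \<le> measure lebesgue ((*\<^sub>R) t ` L)"
    by (intro measure_mono_fmeasurable fmeasurableD lmeasurable_compact star_body_lmeasurable K)
  also have "\<dots> = t ^ CARD('n) * measure lebesgue L"
    using t measure_lebesgue_affine[of t 0 L] by simp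
  finally show ?thesis by (simp add: vol_def)
qed

lemma radial_diff_le_dual_hausdorff:
  assumes "star_body K" "star_body L" "u \<in> sphere 0 1"
  shows "\<bar>radial K u - radial L u\<bar> \<le> dual_hausdorff K L"
  unfolding dual_hausdorff_def
proof (rule cSUP_upper[OF assms(3)])
  show "bdd_above ((\<lambda>u. \<bar>radial K u - radial L u\<bar>) ` sphere 0 1)"
    by (intro bounded_imp_bdd_above compact_imp_bounded compact_continuous_image continuous_intros
        continuous_on_radial assms) simp
qed

lemma vol_tendsto:
  fixes K :: "(real ^ 'n) set"
  assumes K: "star_body K" and Ks: "\<And>k. star_body (Ks k)"
    and lim: "(\<lambda>k. dual_hausdorff (Ks k) K) \<longlonglongrightarrow> 0"
  shows "(\<lambda>k. vol (Ks k)) \<longlonglongrightarrow> vol K"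
proof -
  obtain r R where r: "0 < r" "\<And>u. u \<in> sphere 0 1 \<Longrightarrow> r \<le> radial K u"
    "\<And>u. u \<in> sphere 0 1 \<Longrightarrow> radial K u \<le> R"
    using radial_bounds[OF K] by blast
  \<comment> \<open>Dividing by the lower bound \<open>r\<close> of \<open>radial K\<close> converts
    the additive distance into a relative error: the radial functions agree up to factors
    \<open>1 - d k\<close> and \<open>1 + d k\<close>.\<close>
  define d where "d k = dual_hausdorff (Ks k) K / r" for k
  have d: "d \<longlonglongrightarrow> 0"
    using tendsto_divide[OF lim tendsto_const[of r]] r(1) by (simp add: d_def[abs_def])
  have diff: "\<bar>radial (Ks k) u - radial K u\<bar> \<le> d k * radial K u" if u: "u \<in> sphere 0 1" for k u
  proof -
    have D: "\<bar>radial (Ks k) u - radial K u\<bar> \<le> d k * r"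
      using radial_diff_le_dual_hausdorff[OF Ks K u] r(1) by (simp add: d_def)
    then have "0 \<le> d k * r" by linarith
    then have "0 \<le> d k" using r(1) by (simp add: zero_le_mult_iff)
    then have "d k * r \<le> d k * radial K u" using r(2)[OF u] by (intro mult_left_mono)
    with D show ?thesis by linarith
  qed
  have "\<forall>\<^sub>F k in sequentially. d k < 1" "\<forall>\<^sub>F k in sequentially. -1 < d k"
    using order_tendstoD[OF d] by auto
  then have ev: "\<forall>\<^sub>F k in sequentially. (1 - d k) ^ CARD('n) * vol K \<le> vol (Ks k) \<and>
      vol (Ks k) \<le> (1 + d k) ^ CARD('n) * vol K"
  proof eventually_elim
    case (elim k)
    have "radial (Ks k) u \<le> (1 + d k) * radial K u" if "u \<in> sphere 0 1" for u
      using diff[OF that, of k] by (simp add: algebra_simps abs_le_iff)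
    then have 1: "vol (Ks k) \<le> (1 + d k) ^ CARD('n) * vol K"
      using elim by (intro vol_le_of_radial_le Ks K) auto
    have "radial K u \<le> (1 / (1 - d k)) * radial (Ks k) u" if "u \<in> sphere 0 1" for u
      using diff[OF that, of k] elim by (simp add: field_simps abs_le_iff)
    then have "vol K \<le> (1 / (1 - d k)) ^ CARD('n) * vol (Ks k)"
      using elim by (intro vol_le_of_radial_le Ks K) auto
    then have "(1 - d k) ^ CARD('n) * vol K \<le> vol (Ks k)"
      using elim by (simp add: power_one_over field_simps)
    with 1 show ?case by simp
  qed
  show ?thesis
  proof (rule tendsto_sandwich)
    show "(\<lambda>k. (1 - d k) ^ CARD('n) * vol K) \<longlonglongrightarrow> vol K"
      "(\<lambda>k. (1 + d k) ^ CARD('n) * vol K) \<longlonglongrightarrow> vol K"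
      using d by (auto intro!: tendsto_eq_intros)
    show "\<forall>\<^sub>F k in sequentially. (1 - d k) ^ CARD('n) * vol K \<le> vol (Ks k)"
      "\<forall>\<^sub>F k in sequentially. vol (Ks k) \<le> (1 + d k) ^ CARD('n) * vol K"
      using ev by (auto elim: eventually_mono)
  qed
qed

subsection \<open>Orlicz functions\<close>

context
  fixes \<phi> :: "real \<Rightarrow> real"
  assumes \<phi>: "\<phi> \<in> Orlicz_class"
begin

lemma Orlicz_zero: "\<phi> 0 = 0" and Orlicz_nonneg: "0 \<le> x \<Longrightarrow> 0 \<le> \<phi> x"
  using \<phi> by (auto simp: Orlicz_class_def)

lemma Orlicz_less: "0 \<le> x \<Longrightarrow> x < y \<Longrightarrow> \<phi> x < \<phi> y"
  using \<phi> by (auto simp: Orlicz_class_def strict_mono_on_def)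

lemma Orlicz_mono: "0 \<le> x \<Longrightarrow> x \<le> y \<Longrightarrow> \<phi> x \<le> \<phi> y"
  using Orlicz_less[of x y] by (cases "x = y") auto

lemma Orlicz_one_pos: "0 < \<phi> 1"
  using Orlicz_less[of 0 1] by (simp add: Orlicz_zero)

lemma Orlicz_convex:
  "0 \<le> t \<Longrightarrow> t \<le> 1 \<Longrightarrow> 0 \<le> x \<Longrightarrow> 0 \<le> y \<Longrightarrow> \<phi> ((1 - t) * x + t * y) \<le> (1 - t) * \<phi> x + t * \<phi> y"
  using \<phi> convex_onD[of "{0..}" \<phi> t x y] by (simp add: Orlicz_class_def)

lemma Orlicz_scale_le: "0 \<le> t \<Longrightarrow> t \<le> 1 \<Longrightarrow> 0 \<le> x \<Longrightarrow> \<phi> (t * x) \<le> t * \<phi> x"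
  using Orlicz_convex[of t 0 x] by (simp add: Orlicz_zero)

text \<open>For \<open>x\<close> beyond \<open>1\<close> convexity and \<open>\<phi> 0 = 0\<close>
  make \<open>\<phi> x / x\<close> at least \<open>\<phi> 1\<close>; before \<open>1\<close> the
  left side is not positive. The bound involves \<phi> only through \<open>\<phi> 1\<close>, hence
  the uniformity of the coercivity estimate in \<phi>.\<close>

lemma Orlicz_ge_linear:
  assumes "0 \<le> x"
  shows "\<phi> 1 * (x - 1) \<le> \<phi> x"
proof (cases "x \<le> 1")
  case True
  then have "\<phi> 1 * (x - 1) \<le> 0" using Orlicz_one_pos by (simp add: mult_nonneg_nonpos)
  with Orlicz_nonneg[OF assms] show ?thesis by linarith
next
  case False
  then have "\<phi> 1 \<le> (1 / x) * \<phi> x" using Orlicz_scale_le[of "1 / x" x] by simp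
  then have "\<phi> 1 * x \<le> \<phi> x" using False by (simp add: field_simps)
  with Orlicz_one_pos show ?thesis by (simp add: algebra_simps)
qed

text \<open>Convexity gives continuity only in the open half-line; at \<open>0\<close> the function
  is squeezed between \<open>0\<close> and its chord \<open>x * \<phi> 1\<close>.\<close>

lemma Orlicz_continuous: "continuous_on {0..} \<phi>"
proof -
  have "continuous_on {0<..} \<phi>"
    using \<phi> by (intro convex_on_continuous)
      (auto simp: Orlicz_class_def intro: convex_on_subset[of "{0..}"])
  then have pos: "isCont \<phi> x" if "0 < x" for x
    using that by (simp add: continuous_on_eq_continuous_at)
  have "(\<phi> \<longlongrightarrow> 0) (at 0 within {0..})"
  proof (rule tendsto_sandwich[of "\<lambda>_. 0" _ _ "\<lambda>x. x * \<phi> 1"])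
    show "((\<lambda>x. x * \<phi> 1) \<longlongrightarrow> 0) (at 0 within {0..})" by (auto intro!: tendsto_eq_intros)
    show "\<forall>\<^sub>F x in at 0 within {0..}. 0 \<le> \<phi> x"
      by (auto simp: eventually_at_filter Orlicz_nonneg)
    have "\<forall>\<^sub>F x::real in at 0 within {0..}. x < 1"
      by (auto simp: eventually_at dist_norm intro!: exI[of _ 1])
    moreover have "\<forall>\<^sub>F x::real in at 0 within {0..}. 0 \<le> x"
      by (auto simp: eventually_at_filter)
    ultimately show "\<forall>\<^sub>F x in at 0 within {0..}. \<phi> x \<le> x * \<phi> 1"
      by eventually_elim (use Orlicz_scale_le[of _ 1] in auto)
  qed simp
  then have "continuous (at 0 within {0..}) \<phi>" by (simp add: continuous_within Orlicz_zero)
  with pos show ?thesis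
    unfolding continuous_on_eq_continuous_within
    by (metis atLeast_iff continuous_at_imp_continuous_within less_le)
qed

lemma Orlicz_surj:
  assumes "0 \<le> y"
  obtains x where "0 \<le> x" "\<phi> x = y"
proof -
  \<comment> \<open>Chosen so that the linear lower bound \<open>\<phi> 1 * (b - 1)\<close> equals
    \<open>y\<close>; the intermediate value theorem then applies on \<open>{0..b}\<close>.\<close>
  define b where "b = y / \<phi> 1 + 1"
  have b: "0 \<le> b" using assms Orlicz_one_pos by (simp add: b_def)
  have "y \<le> \<phi> b"
    using Orlicz_ge_linear[OF b] Orlicz_one_pos by (simp add: b_def)
  moreover have "continuous_on {0..b} \<phi>" by (rule continuous_on_subset[OF Orlicz_continuous]) auto
  ultimately show ?thesis
    using IVT'[of \<phi> 0 y b] assms b that by (auto simp: Orlicz_zero)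
qed

text \<open>Surjectivity onto the nonnegative reals makes \<open>inv_into\<close> a genuine inverse
  there, so the constraint in \<open>Orlicz_functional\<close> becomes a comparison with
  \<open>\<phi> 1\<close>.\<close>

lemma Orlicz_inv_le_one_iff:
  assumes "0 \<le> y"
  shows "inv_into {0..} \<phi> y \<le> 1 \<longleftrightarrow> y \<le> \<phi> 1"
proof -
  obtain x where x: "0 \<le> x" "\<phi> x = y" by (rule Orlicz_surj[OF assms])
  have "inj_on \<phi> {0..}"
    using \<phi> by (auto simp: Orlicz_class_def intro: strict_mono_on_imp_inj_on)
  then have "inv_into {0..} \<phi> y = x" using x by (auto simp: inv_into_f_eq)
  moreover have "x \<le> 1 \<longleftrightarrow> \<phi> x \<le> \<phi> 1"
    using Orlicz_mono[of x 1] Orlicz_less[of 1 x] x(1) by force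
  ultimately show ?thesis using x by simp
qed

end

text \<open>Continuous convergence: all \<open>x k\<close> lie in one compact interval, where
  uniform convergence replaces \<open>\<phi>s k\<close> by \<phi>, and continuity of \<phi> does the
  rest.\<close>

lemma Orlicz_tendsto_at:
  assumes \<phi>: "\<phi> \<in> Orlicz_class" and lim: "Orlicz_tendsto \<phi>s \<phi>"
    and x: "x \<longlonglongrightarrow> l" "\<And>k. 0 \<le> x k"
  shows "(\<lambda>k. \<phi>s k (x k)) \<longlonglongrightarrow> \<phi> l"
proof -
  obtain b where b: "\<And>k. norm (x k) \<le> b"
    using convergent_imp_Bseq[of x] x(1) unfolding convergent_def Bseq_def by blast
  have l: "0 \<le> l" using x by (intro LIMSEQ_le_const[OF x(1)]) auto
  have unif: "uniform_limit {0..b} \<phi>s \<phi> sequentially"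
    using lim by (simp add: Orlicz_tendsto_def)
  have mem: "x k \<in> {0..b}" for k using b[of k] x(2)[of k] by simp
  have "(\<lambda>k. \<phi> (x k)) \<longlonglongrightarrow> \<phi> l"
    by (rule continuous_on_tendsto_compose[OF Orlicz_continuous[OF \<phi>] x(1)]) (use l x(2) in auto)
  moreover have "(\<lambda>k. \<phi>s k (x k) - \<phi> (x k)) \<longlonglongrightarrow> 0"
  proof (rule tendstoI)
    fix e :: real assume "0 < e"
    from uniform_limitD[OF unif this] show "\<forall>\<^sub>F k in sequentially. dist (\<phi>s k (x k) - \<phi> (x k)) 0 < e"
      by eventually_elim (use mem in \<open>auto simp: dist_norm\<close>)
  qed
  ultimately show ?thesis by (rule Lim_transform)
qed

lemma Orlicz_tendsto_const: "Orlicz_tendsto (\<lambda>_. \<phi>) \<phi>"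
  by (simp add: Orlicz_tendsto_def uniform_limit_const)

lemma Orlicz_tendsto_subseq:
  assumes "Orlicz_tendsto \<phi>s \<phi>" "filterlim r at_top sequentially"
  shows "Orlicz_tendsto (\<lambda>k. \<phi>s (r k)) \<phi>"
  using assms(1) filterlim_compose[OF _ assms(2), of \<phi>s] by (simp add: Orlicz_tendsto_def)

subsection \<open>Ellipsoids and the Orlicz energy\<close>

definition ellipsoid_of :: "real ^ 'n ^ 'n \<Rightarrow> (real ^ 'n) set" where
  "ellipsoid_of B = {x. norm (B *v x) \<le> 1}"

lemma matrix_image_ball_eq_ellipsoid_of:
  fixes A B :: "real ^ 'n ^ 'n"
  assumes "A ** B = mat 1" "B ** A = mat 1"
  shows "(\<lambda>x. A *v x) ` cball 0 1 = ellipsoid_of B"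
proof (intro set_eqI iffI)
  fix y assume "y \<in> ellipsoid_of B"
  then have "B *v y \<in> cball 0 1" "y = A *v (B *v y)"
    using assms by (simp_all add: ellipsoid_of_def matrix_vector_mul_assoc)
  then show "y \<in> (\<lambda>x. A *v x) ` cball 0 1" by blast
qed (auto simp: ellipsoid_of_def matrix_vector_mul_assoc assms)

lemma ellipsoid_iff:
  fixes E :: "(real ^ 'n) set"
  shows "ellipsoid E \<longleftrightarrow> (\<exists>B. invertible B \<and> E = ellipsoid_of B)"
proof
  assume "ellipsoid E"
  then obtain A :: "real ^ 'n ^ 'n" where A: "invertible A" "E = (\<lambda>x. A *v x) ` cball 0 1"
    unfolding ellipsoid_def by blast
  moreover from A(1) obtain B where "A ** B = mat 1" "B ** A = mat 1"
    by (auto simp: invertible_def)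
  moreover from this have "invertible B" by (auto simp: invertible_def)
  ultimately show "\<exists>B. invertible B \<and> E = ellipsoid_of B"
    using matrix_image_ball_eq_ellipsoid_of by blast
next
  assume "\<exists>B. invertible B \<and> E = ellipsoid_of B"
  then obtain A B where "A ** B = mat 1" "B ** A = mat 1" "E = ellipsoid_of B"
    by (auto simp: invertible_def)
  moreover from this have "invertible A" by (auto simp: invertible_def)
  ultimately show "ellipsoid E"
    using matrix_image_ball_eq_ellipsoid_of unfolding ellipsoid_def by blast
qed

lemma vol_ellipsoid_of:
  fixes B :: "real ^ 'n ^ 'n"
  assumes "invertible B"
  shows "vol (ellipsoid_of B) = measure lebesgue (cball (0 :: real ^ 'n) 1) / \<bar>det B\<bar>"
proof -
  obtain A where A: "A ** B = mat 1" "B ** A = mat 1"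
    using assms by (auto simp: invertible_def)
  have "\<bar>det A\<bar> * \<bar>det B\<bar> = 1"
    using A(1) by (metis abs_1 abs_mult det_I det_mul)
  moreover have "\<bar>det B\<bar> \<noteq> 0" using assms by (simp add: invertible_det_nz)
  ultimately have "\<bar>det A\<bar> = 1 / \<bar>det B\<bar>" by (simp add: field_simps)
  then show ?thesis
    by (simp add: vol_def matrix_image_ball_eq_ellipsoid_of[OF A, symmetric] measure_matrix_image)
qed

lemma matrix_vector_mult_nonzero:
  assumes "invertible (B :: real ^ 'n ^ 'n)" "x \<noteq> 0"
  shows "B *v x \<noteq> 0"
  using assms by (metis invertible_def matrix_vector_mul_assoc matrix_vector_mul_lid matrix_vector_mult_0_right)

lemma radial_ellipsoid_of:
  fixes B :: "real ^ 'n ^ 'n"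
  assumes "invertible B" "u \<in> sphere 0 1"
  shows "radial (ellipsoid_of B) u = 1 / norm (B *v u)"
proof -
  have "0 < norm (B *v u)" using matrix_vector_mult_nonzero[OF assms(1), of u] assms(2) by force
  then have "{c. 0 \<le> c \<and> c *\<^sub>R u \<in> ellipsoid_of B} = {0..1 / norm (B *v u)}"
    by (auto simp: ellipsoid_of_def matrix_vector_mult_scaleR field_simps)
  then show ?thesis by (simp add: radial_def)
qed

text \<open>Radial functions are reciprocals of \<open>norm (B *v u)\<close>. On the sphere this
  norm is at least \<open>m\<close> for \<open>L\<close>, hence eventually at least
  \<open>m / 2\<close> for \<open>Bs k\<close>, and reciprocals are Lipschitz away from
  zero.\<close>

lemma dual_hausdorff_ellipsoid_of_tendsto:
  fixes L :: "real ^ 'n ^ 'n"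
  assumes Bs: "Bs \<longlonglongrightarrow> L" "\<And>k. invertible (Bs k)" and L: "invertible L"
  shows "(\<lambda>k. dual_hausdorff (ellipsoid_of (Bs k)) (ellipsoid_of L)) \<longlonglongrightarrow> 0"
proof -
  have "continuous_on (sphere 0 1) (\<lambda>u. norm (L *v u))" by (intro continuous_intros)
  then obtain u0 where u0: "u0 \<in> sphere 0 1"
    and min: "\<And>u. u \<in> sphere 0 1 \<Longrightarrow> norm (L *v u0) \<le> norm (L *v u)"
    using continuous_attains_inf[OF compact_sphere, of 0 1 "\<lambda>u. norm (L *v u)"] by auto
  define m where "m = norm (L *v u0)"
  have m: "0 < m" using matrix_vector_mult_nonzero[OF L, of u0] u0 by (force simp: m_def)
  have d: "(\<lambda>k. norm (Bs k - L)) \<longlonglongrightarrow> 0"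
    using Bs(1) by (simp add: LIM_zero tendsto_norm_zero)
  have "\<forall>\<^sub>F k in sequentially. norm (Bs k - L) < m / 2"
    using order_tendstoD(2)[OF d, of "m / 2"] m by simp
  then have "\<forall>\<^sub>F k in sequentially.
      norm (dual_hausdorff (ellipsoid_of (Bs k)) (ellipsoid_of L)) \<le> norm (Bs k - L) / (m / 2 * m)"
  proof eventually_elim
    case (elim k)
    have "\<bar>radial (ellipsoid_of (Bs k)) u - radial (ellipsoid_of L) u\<bar> \<le> norm (Bs k - L) / (m / 2 * m)"
      if u: "u \<in> sphere 0 1" for u
    proof -
      define p q where "p = norm (Bs k *v u)" and "q = norm (L *v u)"
      have pq: "\<bar>p - q\<bar> \<le> norm (Bs k - L)"
        unfolding p_def q_def using u by (intro abs_norm_matrix_vector_diff_le) simp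
      have q: "m \<le> q" using min[OF u] by (simp add: m_def q_def)
      with pq elim have p: "m / 2 \<le> p" by linarith
      have "1 / p - 1 / q = (q - p) / (p * q)"
        using p q m by (simp add: diff_frac_eq)
      then have "\<bar>1 / p - 1 / q\<bar> = \<bar>p - q\<bar> / (p * q)"
        using p q m by (simp add: abs_mult abs_minus_commute)
      also have "\<dots> \<le> norm (Bs k - L) / (m / 2 * m)"
        using p q m pq by (intro frac_le mult_mono) auto
      finally show ?thesis
          by (simp add: radial_ellipsoid_of[OF Bs(2) u] radial_ellipsoid_of[OF L u] p_def q_def)
    qed
    then show ?case
      unfolding dual_hausdorff_def real_norm_def by (intro cSup_abs_le) auto
  qed
  moreover have "(\<lambda>k. norm (Bs k - L) / (m / 2 * m)) \<longlonglongrightarrow> 0"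
    using m by (intro tendsto_divide_zero d)
  ultimately show ?thesis by (rule Lim_null_comparison)
qed

section \<open>The energy of a matrix: convexity, coercivity, joint continuity\<close>

definition cone_density :: "(real ^ 'n) set \<Rightarrow> real ^ 'n \<Rightarrow> real" where
  "cone_density K u = radial K u ^ CARD('n) / (real CARD('n) * vol K)"

text \<open>For invertible \<open>B\<close> this is the integral in \<open>Orlicz_functional\<close>
  at \<open>c = 1\<close> for the body \<open>ellipsoid_of B\<close>. The formula also makes sense
  for singular \<open>B\<close>, so limits of matrices need no special care.\<close>

definition Orlicz_energy :: "(real \<Rightarrow> real) \<Rightarrow> (real ^ 'n) set \<Rightarrow> real ^ 'n ^ 'n \<Rightarrow> real" where
  "Orlicz_energy \<phi> K B =
     (\<integral>u. \<phi> (radial K u * norm (B *v u)) * cone_density K u \<partial>sphere_measure)"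

lemma cone_density_pos: "star_body K \<Longrightarrow> u \<in> sphere 0 1 \<Longrightarrow> 0 < cone_density K u"
  by (simp add: cone_density_def vol_pos radial_pos)

lemma radial_norm_nonneg:
  "star_body K \<Longrightarrow> u \<in> sphere 0 1 \<Longrightarrow> 0 \<le> radial K u * norm (B *v u)"
  by (meson less_imp_le mult_nonneg_nonneg norm_ge_zero radial_pos)

lemma continuous_on_cone_density: "star_body K \<Longrightarrow> continuous_on (sphere 0 1) (cone_density K)"
  unfolding cone_density_def
  by (intro continuous_intros continuous_on_radial) (use vol_pos in fastforce)+

lemma integral_dual_cone_measure:
  fixes K :: "(real ^ 'n) set"
  assumes K: "star_body K" and f: "continuous_on (sphere 0 1) f"
  shows "(\<integral>u. f u \<partial>dual_cone_measure K) = (\<integral>u. f u * cone_density K u \<partial>sphere_measure)"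
proof -
  have "(\<integral>u. f u \<partial>dual_cone_measure K) = (\<integral>u. cone_density K u *\<^sub>R f u \<partial>sphere_measure)"
    unfolding dual_cone_measure_def cone_density_def[symmetric]
    by (intro integral_density borel_measurable_sphere_measure continuous_on_cone_density K f AE_I2)
      (use cone_density_pos[OF K] in \<open>simp add: less_imp_le\<close>)
  then show ?thesis by (simp add: mult.commute)
qed

context
  fixes \<phi> :: "real \<Rightarrow> real" and K :: "(real ^ 'n) set"
  assumes \<phi>: "\<phi> \<in> Orlicz_class" and K: "star_body K"
begin

lemma continuous_on_Orlicz_radial:
  "continuous_on (sphere 0 1) (\<lambda>u. \<phi> (radial K u * norm (B *v u)))"
  by (rule continuous_on_compose2[OF Orlicz_continuous[OF \<phi>]])
    (auto intro!: continuous_intros continuous_on_radial K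
      mult_nonneg_nonneg less_imp_le[OF radial_pos[OF K]])

lemma continuous_on_energy_integrand:
  "continuous_on (sphere 0 1) (\<lambda>u. \<phi> (radial K u * norm (B *v u)) * cone_density K u)"
  by (intro continuous_on_mult continuous_on_Orlicz_radial continuous_on_cone_density K)

lemmas integrable_energy_integrand = integrable_sphere_measure[OF continuous_on_energy_integrand]



lemma Orlicz_energy_nonneg: "0 \<le> Orlicz_energy \<phi> K B"
  unfolding Orlicz_energy_def
  by (intro integral_nonneg_AE AE_I2 mult_nonneg_nonneg Orlicz_nonneg[OF \<phi>] radial_norm_nonneg[OF K]
      less_imp_le[OF cone_density_pos[OF K]]) auto

lemma Orlicz_energy_mono:
  assumes "\<And>u. u \<in> sphere 0 1 \<Longrightarrow> norm (A *v u) \<le> norm (B *v u)"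
  shows "Orlicz_energy \<phi> K A \<le> Orlicz_energy \<phi> K B"
  unfolding Orlicz_energy_def
proof (intro integral_mono integrable_energy_integrand mult_right_mono)
  fix u :: "real ^ 'n" assume "u \<in> space sphere_measure"
  then have u: "u \<in> sphere 0 1" by simp
  show "0 \<le> cone_density K u" using cone_density_pos[OF K u] by simp
  show "\<phi> (radial K u * norm (A *v u)) \<le> \<phi> (radial K u * norm (B *v u))"
    using assms[OF u] radial_pos[OF K u]
    by (intro Orlicz_mono[OF \<phi>] radial_norm_nonneg[OF K u] mult_left_mono) auto
qed

text \<open>Convexity together with \<open>\<phi> 0 = 0\<close>. This is the source of strictly
  feasible matrices: shrinking a feasible one creates slack.\<close>

lemma Orlicz_energy_scaleR_le:
  assumes t: "0 \<le> t" "t \<le> 1"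
  shows "Orlicz_energy \<phi> K (t *\<^sub>R B) \<le> t * Orlicz_energy \<phi> K B"
proof -
  have "Orlicz_energy \<phi> K (t *\<^sub>R B) \<le>
      (\<integral>u. t * (\<phi> (radial K u * norm (B *v u)) * cone_density K u) \<partial>sphere_measure)"
    unfolding Orlicz_energy_def
  proof (intro integral_mono integrable_energy_integrand integrable_mult_right)
    fix u :: "real ^ 'n" assume "u \<in> space sphere_measure"
    then have u: "u \<in> sphere 0 1" by simp
    have "radial K u * norm ((t *\<^sub>R B) *v u) = t * (radial K u * norm (B *v u))"
      using t by (simp add: scaleR_matrix_vector_assoc[symmetric])
    with Orlicz_scale_le[OF \<phi> t radial_norm_nonneg[OF K u, of B]]
    have "\<phi> (radial K u * norm ((t *\<^sub>R B) *v u)) \<le> t * \<phi> (radial K u * norm (B *v u))"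
      by (simp only:)
    from mult_right_mono[OF this less_imp_le[OF cone_density_pos[OF K u]]]
    show "\<phi> (radial K u * norm ((t *\<^sub>R B) *v u)) * cone_density K u
        \<le> t * (\<phi> (radial K u * norm (B *v u)) * cone_density K u)"
      by (simp add: mult.assoc)
  qed
  then show ?thesis by (simp add: Orlicz_energy_def)
qed

text \<open>The triangle inequality, monotonicity of \<phi> and convexity of \<phi>, applied in this
  order under the integral.\<close>

lemma Orlicz_energy_midpoint_le:
  "Orlicz_energy \<phi> K ((1/2) *\<^sub>R (A + B)) \<le> (Orlicz_energy \<phi> K A + Orlicz_energy \<phi> K B) / 2"
proof -
  let ?f = "\<lambda>B u. \<phi> (radial K u * norm (B *v u)) * cone_density K u"
  have "Orlicz_energy \<phi> K ((1/2) *\<^sub>R (A + B)) \<le> (\<integral>u. (?f A u + ?f B u) / 2 \<partial>sphere_measure)"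
    unfolding Orlicz_energy_def
  proof (intro integral_mono integrable_energy_integrand integrable_divide
      Bochner_Integration.integrable_add)
    fix u :: "real ^ 'n" assume "u \<in> space sphere_measure"
    then have u: "u \<in> sphere 0 1" by simp
    let ?a = "radial K u * norm (A *v u)" and ?b = "radial K u * norm (B *v u)"
    have "norm (((1/2) *\<^sub>R (A + B)) *v u) \<le> (norm (A *v u) + norm (B *v u)) / 2"
      by (simp add: scaleR_matrix_vector_assoc[symmetric] matrix_vector_mult_add_rdistrib
          norm_triangle_ineq)
    from mult_left_mono[OF this less_imp_le[OF radial_pos[OF K u]]]
    have "radial K u * norm (((1/2) *\<^sub>R (A + B)) *v u) \<le> (1 - 1/2) * ?a + 1/2 * ?b"
      by (simp add: algebra_simps)
    then have "\<phi> (radial K u * norm (((1/2) *\<^sub>R (A + B)) *v u)) \<le> \<phi> ((1 - 1/2) * ?a + 1/2 * ?b)"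
      by (intro Orlicz_mono[OF \<phi>] radial_norm_nonneg[OF K u])
    also have "\<dots> \<le> (1 - 1/2) * \<phi> ?a + 1/2 * \<phi> ?b"
      by (rule Orlicz_convex[OF \<phi>]) (simp_all add: radial_norm_nonneg[OF K u])
    finally have "\<phi> (radial K u * norm (((1/2) *\<^sub>R (A + B)) *v u)) \<le> (\<phi> ?a + \<phi> ?b) / 2" by simp
    from mult_right_mono[OF this less_imp_le[OF cone_density_pos[OF K u]]]
    show "?f ((1/2) *\<^sub>R (A + B)) u \<le> (?f A u + ?f B u) / 2"
      by (simp add: field_simps)
  qed
  then show ?thesis by (simp add: Orlicz_energy_def integrable_energy_integrand)
qed

text \<open>Integrating the linear lower bound for \<phi>, divided by \<open>\<phi> 1\<close>,
  against the cone density. The body enters only through \<open>a\<close> and \<open>b\<close>, so a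
  whole sequence of bodies can share the estimate.\<close>

lemma Orlicz_energy_coercive:
  assumes a: "\<And>u. u \<in> sphere 0 1 \<Longrightarrow> a \<le> radial K u * cone_density K u"
    and b: "\<And>u. u \<in> sphere 0 1 \<Longrightarrow> cone_density K u \<le> b"
    and B: "Orlicz_energy \<phi> K B \<le> \<phi> 1"
  shows "a * (\<integral>u. norm (B *v u) \<partial>sphere_measure)
    \<le> b * measure sphere_measure (sphere 0 1 :: (real ^ 'n) set) + 1"
proof -
  let ?f = "\<lambda>u. \<phi> (radial K u * norm (B *v u)) * cone_density K u"
  note one = Orlicz_one_pos[OF \<phi>]
  have "a * (\<integral>u. norm (B *v u) \<partial>sphere_measure) = (\<integral>u. a * norm (B *v u) \<partial>sphere_measure)"
    by simp
  also have "\<dots> \<le> (\<integral>u. b + ?f u / \<phi> 1 \<partial>sphere_measure)"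
  proof (intro integral_mono Bochner_Integration.integrable_add integrable_divide
      integrable_energy_integrand sphere_measure.integrable_const integrable_sphere_measure
      continuous_intros)
    fix u :: "real ^ 'n" assume "u \<in> space sphere_measure"
    then have u: "u \<in> sphere 0 1" by simp
    let ?x = "radial K u * norm (B *v u)"
    have "?x \<le> 1 + \<phi> ?x / \<phi> 1"
      using Orlicz_ge_linear[OF \<phi> radial_norm_nonneg[OF K u]] one by (simp add: field_simps)
    from mult_right_mono[OF this less_imp_le[OF cone_density_pos[OF K u]]]
    have "?x * cone_density K u \<le> cone_density K u + ?f u / \<phi> 1"
      by (simp add: algebra_simps)
    moreover have "a * norm (B *v u) \<le> ?x * cone_density K u"
      using mult_right_mono[OF a[OF u], of "norm (B *v u)"] by (simp add: mult_ac)
    ultimately show "a * norm (B *v u) \<le> b + ?f u / \<phi> 1" using b[OF u] by linarith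
  qed
  also have "\<dots> = b * measure sphere_measure (sphere 0 1 :: (real ^ 'n) set) + Orlicz_energy \<phi> K B / \<phi> 1"
    by (subst Bochner_Integration.integral_add)
      (simp_all add: integrable_energy_integrand Orlicz_energy_def)
  also have "Orlicz_energy \<phi> K B / \<phi> 1 \<le> 1" using B one by simp
  finally show ?thesis by simp
qed

end

lemma radial_tendsto:
  assumes "star_body K" "\<And>k. star_body (Ks k)" "(\<lambda>k. dual_hausdorff (Ks k) K) \<longlonglongrightarrow> 0"
    "u \<in> sphere 0 1"
  shows "(\<lambda>k. radial (Ks k) u) \<longlonglongrightarrow> radial K u"
proof -
  have "(\<lambda>k. radial (Ks k) u - radial K u) \<longlonglongrightarrow> 0"
    using radial_diff_le_dual_hausdorff[OF assms(2,1,4)]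
    by (intro Lim_null_comparison[OF _ assms(3)] always_eventually allI) simp
  then show ?thesis by (rule LIM_zero_cancel)
qed

text \<open>Dominated convergence with a constant bound; pointwise convergence of the integrand is
  continuous convergence of \<open>\<phi>s\<close>.\<close>

lemma Orlicz_energy_tendsto:
  fixes K :: "(real ^ 'n) set"
  assumes K: "star_body K" and Ks: "\<And>k. star_body (Ks k)"
    and dist: "(\<lambda>k. dual_hausdorff (Ks k) K) \<longlonglongrightarrow> 0"
    and \<phi>: "\<phi> \<in> Orlicz_class" and \<phi>s: "\<And>k. \<phi>s k \<in> Orlicz_class" and lim: "Orlicz_tendsto \<phi>s \<phi>"
    and Bs: "Bs \<longlonglongrightarrow> B"
  shows "(\<lambda>k. Orlicz_energy (\<phi>s k) (Ks k) (Bs k)) \<longlonglongrightarrow> Orlicz_energy \<phi> K B"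
proof -
  obtain r R0 where "0 < r" "\<And>u. u \<in> sphere 0 1 \<Longrightarrow> r \<le> radial K u"
    and R0: "\<And>u. u \<in> sphere 0 1 \<Longrightarrow> radial K u \<le> R0"
    using radial_bounds[OF K] by blast
  obtain D where D: "\<And>k. norm (dual_hausdorff (Ks k) K) \<le> D"
    using convergentI[OF dist, THEN convergent_imp_Bseq] unfolding Bseq_def by blast
  obtain M where M: "\<And>k. norm (Bs k) \<le> M" "0 < M"
    using convergentI[OF Bs, THEN convergent_imp_Bseq] unfolding Bseq_def by blast
  define R where "R = R0 + D"
  have R: "radial (Ks k) u \<le> R" if "u \<in> sphere 0 1" for u k
    using radial_diff_le_dual_hausdorff[OF Ks K that, of k] R0[OF that] D[of k] by (simp add: R_def)
  obtain u0 :: "real ^ 'n" where u0: "u0 \<in> sphere 0 1"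
    using vector_choose_size[of 1] by auto
  have R_pos: "0 < R" using R[OF u0, of 0] radial_pos[OF Ks[of 0] u0] by simp
  have volinv: "(\<lambda>k. inverse (vol (Ks k))) \<longlonglongrightarrow> inverse (vol K)"
    using vol_pos[OF K] by (intro tendsto_inverse vol_tendsto K Ks dist) simp
  obtain W where W: "\<And>k. norm (inverse (vol (Ks k))) \<le> W"
    using convergentI[OF volinv, THEN convergent_imp_Bseq] unfolding Bseq_def by blast
  \<comment> \<open>By monotonicity, the values at the one point \<open>R * M\<close> dominate all
    arguments that occur, and they converge, hence are bounded in \<open>k\<close>.\<close>
  have "(\<lambda>k. \<phi>s k (R * M)) \<longlonglongrightarrow> \<phi> (R * M)"
    using R_pos M by (intro Orlicz_tendsto_at[OF \<phi> lim]) auto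
  from convergentI[OF this, THEN convergent_imp_Bseq]
  obtain C where C: "\<And>k. norm (\<phi>s k (R * M)) \<le> C" unfolding Bseq_def by blast
  show ?thesis
    unfolding Orlicz_energy_def
  proof (rule integral_dominated_convergence[where w = "\<lambda>_. C * (R ^ CARD('n) / CARD('n) * W)"])
    show "(\<lambda>u. \<phi> (radial K u * norm (B *v u)) * cone_density K u) \<in> borel_measurable sphere_measure"
      by (intro borel_measurable_sphere_measure continuous_on_energy_integrand \<phi> K)
    show "(\<lambda>u. \<phi>s k (radial (Ks k) u * norm (Bs k *v u)) * cone_density (Ks k) u)
        \<in> borel_measurable sphere_measure" for k
      by (intro borel_measurable_sphere_measure continuous_on_energy_integrand \<phi>s Ks)
    show "integrable sphere_measure (\<lambda>_ :: real ^ 'n. C * (R ^ CARD('n) / CARD('n) * W))" by simp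
    show "AE u in sphere_measure. (\<lambda>k. \<phi>s k (radial (Ks k) u * norm (Bs k *v u)) * cone_density (Ks k) u)
        \<longlonglongrightarrow> \<phi> (radial K u * norm (B *v u)) * cone_density K u"
    proof (intro AE_I2 tendsto_mult)
      fix u :: "real ^ 'n" assume "u \<in> space sphere_measure"
      then have u: "u \<in> sphere 0 1" by simp
      have "(\<lambda>k. Bs k *v u) \<longlonglongrightarrow> B *v u"
        unfolding matrix_vector_mult_def by (intro tendsto_intros Bs)
      then show "(\<lambda>k. \<phi>s k (radial (Ks k) u * norm (Bs k *v u))) \<longlonglongrightarrow> \<phi> (radial K u * norm (B *v u))"
        by (intro Orlicz_tendsto_at[OF \<phi> lim] tendsto_mult tendsto_norm
            radial_tendsto[OF K Ks dist u] radial_norm_nonneg[OF Ks u])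
      show "(\<lambda>k. cone_density (Ks k) u) \<longlonglongrightarrow> cone_density K u"
        unfolding cone_density_def using vol_pos[OF K]
        by (intro tendsto_intros radial_tendsto[OF K Ks dist u] vol_tendsto K Ks dist) simp
    qed
    show "AE u in sphere_measure. norm (\<phi>s k (radial (Ks k) u * norm (Bs k *v u)) * cone_density (Ks k) u)
        \<le> C * (R ^ CARD('n) / CARD('n) * W)" for k
    proof (intro AE_I2)
      fix u :: "real ^ 'n" assume "u \<in> space sphere_measure"
      then have u: "u \<in> sphere 0 1" by simp
      note rp = radial_pos[OF Ks u, of k]
      note nn = radial_norm_nonneg[OF Ks[of k] u, of "Bs k"]
      have "norm (Bs k *v u) \<le> M"
        using norm_matrix_vector_mult_le[of "Bs k" u] M(1)[of k] u by simp
      then have "radial (Ks k) u * norm (Bs k *v u) \<le> R * M"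
        using R[OF u, of k] rp R_pos by (intro mult_mono) auto
      then have "\<phi>s k (radial (Ks k) u * norm (Bs k *v u)) \<le> \<phi>s k (R * M)"
        by (rule Orlicz_mono[OF \<phi>s nn])
      then have "\<phi>s k (radial (Ks k) u * norm (Bs k *v u)) \<le> C"
        using C[of k] by simp
      moreover have "cone_density (Ks k) u \<le> R ^ CARD('n) / CARD('n) * W"
      proof -
        have "cone_density (Ks k) u = radial (Ks k) u ^ CARD('n) / CARD('n) * inverse (vol (Ks k))"
          by (simp add: cone_density_def divide_inverse)
        also have "\<dots> \<le> R ^ CARD('n) / CARD('n) * W"
          using W[of k] R[OF u, of k] rp vol_pos[OF Ks, of k] R_pos
          by (intro mult_mono divide_right_mono power_mono) auto
        finally show ?thesis .
      qed
      moreover have nonneg: "0 \<le> \<phi>s k (radial (Ks k) u * norm (Bs k *v u))" "0 \<le> cone_density (Ks k) u"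
        using Orlicz_nonneg[OF \<phi>s nn] cone_density_pos[OF Ks u, of k] by simp_all
      ultimately have "\<phi>s k (radial (Ks k) u * norm (Bs k *v u)) * cone_density (Ks k) u
          \<le> C * (R ^ CARD('n) / CARD('n) * W)"
        by (intro mult_mono) linarith+
      then show "norm (\<phi>s k (radial (Ks k) u * norm (Bs k *v u)) * cone_density (Ks k) u)
          \<le> C * (R ^ CARD('n) / CARD('n) * W)"
        unfolding real_norm_def abs_of_nonneg[OF mult_nonneg_nonneg[OF nonneg]] .
    qed
  qed
qed

subsection \<open>Optimal matrices\<close>

lemma dual_hausdorff_self: "dual_hausdorff (K :: (real ^ 'n) set) K = 0"
proof -
  have "sphere (0 :: real ^ 'n) 1 \<noteq> {}" by simp
  then show ?thesis by (simp add: dual_hausdorff_def)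
qed

lemma Orlicz_energy_tendsto_const:
  assumes "\<phi> \<in> Orlicz_class" "star_body K" "Bs \<longlonglongrightarrow> B"
  shows "(\<lambda>k. Orlicz_energy \<phi> K (Bs k)) \<longlonglongrightarrow> Orlicz_energy \<phi> K B"
  by (rule Orlicz_energy_tendsto[OF assms(2,2) _ assms(1,1) Orlicz_tendsto_const assms(3)])
    (simp add: dual_hausdorff_self)

lemma det_scaleR: "det (t *\<^sub>R B) = t ^ CARD('n) * det (B :: real ^ 'n ^ 'n)"
proof -
  have "t *\<^sub>R B = diagonal_matrix (\<lambda>_. t) ** B"
    by (simp add: vec_eq_iff diagonal_matrix_mult_left)
  then show ?thesis by (simp add: det_mul det_diagonal_matrix)
qed

lemma tendsto_det:
  fixes L :: "real ^ 'n ^ 'n"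
  shows "(Bs \<longlongrightarrow> L) F \<Longrightarrow> ((\<lambda>k. det (Bs k)) \<longlongrightarrow> det L) F"
  unfolding det_def
  by (intro tendsto_sum tendsto_mult tendsto_const tendsto_prod tendsto_vec_nth)

text \<open>Scaling the ellipsoid by \<open>c\<close> replaces \<open>B\<close> by
  \<open>(1 / c) *\<^sub>R B\<close>. The infimum is not known to be attained, so the forward
  direction takes admissible \<open>c\<close> just above \<open>1\<close> and passes to the
  limit.\<close>

lemma Orlicz_functional_le_one_iff:
  fixes B :: "real ^ 'n ^ 'n"
  assumes \<phi>: "\<phi> \<in> Orlicz_class" and K: "star_body K" and B: "invertible B"
  shows "Orlicz_functional \<phi> K (ellipsoid_of B) \<le> 1 \<longleftrightarrow> Orlicz_energy \<phi> K B \<le> \<phi> 1"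
proof -
  let ?C = "{c. 0 < c \<and> Orlicz_energy \<phi> K ((1 / c) *\<^sub>R B) \<le> \<phi> 1}"
  have int: "(\<integral>u. \<phi> (radial K u / (c * radial (ellipsoid_of B) u)) \<partial>dual_cone_measure K) =
      Orlicz_energy \<phi> K ((1 / c) *\<^sub>R B)" if c: "0 < c" for c
  proof -
    have "radial K u / (c * radial (ellipsoid_of B) u) = radial K u * norm (((1 / c) *\<^sub>R B) *v u)"
      if "u \<in> sphere 0 1" for u
      using c radial_ellipsoid_of[OF B that]
      by (simp add: scaleR_matrix_vector_assoc[symmetric])
    then have "(\<integral>u. \<phi> (radial K u / (c * radial (ellipsoid_of B) u)) \<partial>dual_cone_measure K) =
        (\<integral>u. \<phi> (radial K u * norm (((1 / c) *\<^sub>R B) *v u)) \<partial>dual_cone_measure K)"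
      by (intro Bochner_Integration.integral_cong refl arg_cong[of _ _ \<phi>])
        (simp add: dual_cone_measure_def)
    also have "\<dots> = Orlicz_energy \<phi> K ((1 / c) *\<^sub>R B)"
      unfolding Orlicz_energy_def
      by (intro integral_dual_cone_measure K continuous_on_Orlicz_radial \<phi>)
    finally show ?thesis .
  qed
  have C: "Orlicz_functional \<phi> K (ellipsoid_of B) = Inf ?C"
    unfolding Orlicz_functional_def
    by (intro arg_cong[of _ _ Inf] Collect_cong conj_cong refl)
      (simp only: int Orlicz_inv_le_one_iff[OF \<phi> Orlicz_energy_nonneg[OF \<phi> K]])
  have bdd: "bdd_below ?C" by (rule bdd_belowI[of _ 0]) auto
  show ?thesis
  proof
    assume "Orlicz_energy \<phi> K B \<le> \<phi> 1"
    then have "1 \<in> ?C" by simp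
    then show "Orlicz_functional \<phi> K (ellipsoid_of B) \<le> 1"
      unfolding C by (rule cInf_lower[OF _ bdd])
  next
    assume le: "Orlicz_functional \<phi> K (ellipsoid_of B) \<le> 1"
    \<comment> \<open>The infimum carries information only for a nonempty set: for large
      \<open>c\<close> the scaled matrix tends to \<open>0\<close>, whose energy \<open>0\<close>
      lies below \<open>\<phi> 1\<close>.\<close>
    have "?C \<noteq> {}"
    proof -
      have "(\<lambda>k. Orlicz_energy \<phi> K (inverse (real (Suc k)) *\<^sub>R B)) \<longlonglongrightarrow> Orlicz_energy \<phi> K (0 *\<^sub>R B)"
        by (intro Orlicz_energy_tendsto_const[OF \<phi> K] tendsto_scaleR tendsto_const
            LIMSEQ_inverse_real_of_nat)
      moreover have "Orlicz_energy \<phi> K (0 *\<^sub>R B) < \<phi> 1"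
        using Orlicz_one_pos[OF \<phi>] by (simp add: Orlicz_energy_def Orlicz_zero[OF \<phi>])
      ultimately have "\<forall>\<^sub>F k in sequentially. Orlicz_energy \<phi> K (inverse (real (Suc k)) *\<^sub>R B) < \<phi> 1"
        by (rule order_tendstoD)
      then obtain k where "Orlicz_energy \<phi> K (inverse (real (Suc k)) *\<^sub>R B) < \<phi> 1"
        using eventually_happens'[OF sequentially_bot] by blast
      then have "real (Suc k) \<in> ?C" by (simp add: inverse_eq_divide)
      then show ?thesis by blast
    qed
    have feas: "Orlicz_energy \<phi> K ((1 / (1 + inverse (real (Suc k)))) *\<^sub>R B) \<le> \<phi> 1" for k
    proof -
      have "Inf ?C < 1 + inverse (real (Suc k))"
        using le unfolding C by (rule le_less_trans) simp
      then obtain c where c: "0 < c" "Orlicz_energy \<phi> K ((1 / c) *\<^sub>R B) \<le> \<phi> 1"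
        "c < 1 + inverse (real (Suc k))"
        using cInf_lessD[OF \<open>?C \<noteq> {}\<close>] by blast
      have "1 / (1 + inverse (real (Suc k))) \<le> 1 / c" using c by (intro frac_le) auto
      then have "Orlicz_energy \<phi> K ((1 / (1 + inverse (real (Suc k)))) *\<^sub>R B) \<le> Orlicz_energy \<phi> K ((1 / c) *\<^sub>R B)"
      proof (intro Orlicz_energy_mono[OF \<phi> K])
        fix u
        have "norm ((s *\<^sub>R B) *v u) = s * norm (B *v u)" if "0 \<le> s" for s
          using that by (simp add: scaleR_matrix_vector_assoc[symmetric])
        moreover have "0 \<le> 1 / (1 + inverse (real (Suc k)))" "0 \<le> 1 / c" using c(1) by simp_all
        ultimately show "norm (((1 / (1 + inverse (real (Suc k)))) *\<^sub>R B) *v u)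
            \<le> norm (((1 / c) *\<^sub>R B) *v u)"
          using mult_right_mono[OF \<open>1 / (1 + inverse (real (Suc k))) \<le> 1 / c\<close> norm_ge_zero]
          by (simp only:)
      qed
      with c(2) show ?thesis by linarith
    qed
    have "(\<lambda>k. (1 / (1 + inverse (real (Suc k)))) *\<^sub>R B) \<longlonglongrightarrow> (1 / (1 + 0)) *\<^sub>R B"
      by (intro tendsto_scaleR tendsto_divide tendsto_add tendsto_const
          LIMSEQ_inverse_real_of_nat) simp
    from LIMSEQ_le_const2[OF Orlicz_energy_tendsto_const[OF \<phi> K this], of "\<phi> 1"] feas
    show "Orlicz_energy \<phi> K B \<le> \<phi> 1" by simp
  qed
qed

section \<open>Existence and uniqueness of optimal matrices\<close>

definition optimal_matrix :: "(real \<Rightarrow> real) \<Rightarrow> (real ^ 'n) set \<Rightarrow> real ^ 'n ^ 'n \<Rightarrow> bool" where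
  "optimal_matrix \<phi> K B \<longleftrightarrow> Orlicz_energy \<phi> K B \<le> \<phi> 1 \<and>
     (\<forall>B'. Orlicz_energy \<phi> K B' \<le> \<phi> 1 \<longrightarrow> \<bar>det B'\<bar> \<le> \<bar>det B\<bar>)"

lemma ex_feasible_scaled_identity:
  fixes K :: "(real ^ 'n) set"
  assumes \<phi>: "\<phi> \<in> Orlicz_class" and K: "star_body K"
  obtains t where "0 < t" "Orlicz_energy \<phi> K (t *\<^sub>R mat 1) \<le> \<phi> 1"
proof -
  let ?E = "Orlicz_energy \<phi> K (mat 1)"
  have "0 \<le> ?E" by (rule Orlicz_energy_nonneg[OF \<phi> K])
  have one: "0 < \<phi> 1" by (rule Orlicz_one_pos[OF \<phi>])
  \<comment> \<open>Small enough that \<open>t * ?E\<close> is at most \<open>\<phi> 1\<close>, and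
    at most \<open>1\<close> so that the scaling estimate applies.\<close>
  define t where "t = \<phi> 1 / (\<phi> 1 + ?E)"
  have t: "0 < t" "t \<le> 1" using \<open>0 \<le> ?E\<close> one by (auto simp: t_def)
  have "Orlicz_energy \<phi> K (t *\<^sub>R mat 1) \<le> t * ?E"
    using t by (intro Orlicz_energy_scaleR_le[OF \<phi> K]) auto
  also have "\<dots> \<le> \<phi> 1" using \<open>0 \<le> ?E\<close> one by (simp add: t_def field_simps)
  finally show ?thesis using t(1) that by blast
qed

lemma optimal_matrix_invertible:
  fixes K :: "(real ^ 'n) set"
  assumes "\<phi> \<in> Orlicz_class" "star_body K" "optimal_matrix \<phi> K B"
  shows "invertible B"
proof -
  obtain t where t: "0 < t" "Orlicz_energy \<phi> K (t *\<^sub>R mat 1) \<le> \<phi> 1"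
    by (rule ex_feasible_scaled_identity[OF assms(1,2)])
  have "0 < \<bar>det (t *\<^sub>R mat 1 :: real ^ 'n ^ 'n)\<bar>"
    using t(1) by (simp add: det_scaleR)
  also have "\<dots> \<le> \<bar>det B\<bar>" using assms(3) t(2) by (simp add: optimal_matrix_def)
  finally show ?thesis by (simp add: invertible_det_nz)
qed

text \<open>Convergence of the bodies pins their radial functions and volumes between fixed bounds
  for large \<open>k\<close>, so the coercivity estimate holds with the same constants along the
  tail.\<close>

lemma feasible_imp_Bseq:
  fixes K :: "(real ^ 'n) set"
  assumes K: "star_body K" and Ks: "\<And>k. star_body (Ks k)"
    and dist: "(\<lambda>k. dual_hausdorff (Ks k) K) \<longlonglongrightarrow> 0"
    and \<phi>s: "\<And>k. \<phi>s k \<in> Orlicz_class"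
    and feas: "\<And>k. Orlicz_energy (\<phi>s k) (Ks k) (Bs k) \<le> \<phi>s k 1"
  shows "Bseq Bs"
proof -
  obtain r R where r: "0 < r" "\<And>u. u \<in> sphere 0 1 \<Longrightarrow> r \<le> radial K u"
    and R: "\<And>u. u \<in> sphere 0 1 \<Longrightarrow> radial K u \<le> R"
    using radial_bounds[OF K] by blast
  obtain c where c: "0 < c"
    "\<And>B :: real ^ 'n ^ 'n. c * norm B \<le> (\<integral>u. norm (B *v u) \<partial>sphere_measure)"
    using integral_norm_matrix_ge by blast
  let ?n = "CARD('n)" and ?V = "vol K"
  let ?s = "measure sphere_measure (sphere 0 1 :: (real ^ 'n) set)"
  \<comment> \<open>The extreme values of the coercivity constants when radial functions range
    between \<open>r / 2\<close> and \<open>R + r\<close> and volumes between half and twice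
    \<open>?V\<close>.\<close>
  define a where "a = r / 2 * ((r / 2) ^ ?n / (?n * (2 * ?V)))"
  define b where "b = (R + r) ^ ?n / (?n * (?V / 2))"
  have V: "0 < ?V" by (rule vol_pos[OF K])
  have a: "0 < a" using r(1) V by (simp add: a_def)
  note volt = vol_tendsto[OF K Ks dist]
  have ev: "\<forall>\<^sub>F k in sequentially. dual_hausdorff (Ks k) K < r / 2"
    "\<forall>\<^sub>F k in sequentially. vol (Ks k) < 2 * ?V" "\<forall>\<^sub>F k in sequentially. ?V / 2 < vol (Ks k)"
    using order_tendstoD(2)[OF dist, of "r / 2"] order_tendstoD(2)[OF volt, of "2 * ?V"]
      order_tendstoD(1)[OF volt, of "?V / 2"] r(1) V by simp_all
  then have "\<forall>\<^sub>F k in sequentially. norm (Bs k) \<le> (b * ?s + 1) / (a * c)"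
  proof eventually_elim
    case (elim k)
    have rad: "r / 2 \<le> radial (Ks k) u" "radial (Ks k) u \<le> R + r" if "u \<in> sphere 0 1" for u
      using radial_diff_le_dual_hausdorff[OF Ks K that, of k] r(2)[OF that] R[OF that] elim(1) r(1)
      by linarith+
    have "a * (\<integral>u. norm (Bs k *v u) \<partial>sphere_measure) \<le> b * ?s + 1"
    proof (rule Orlicz_energy_coercive[OF \<phi>s Ks _ _ feas])
      fix u :: "real ^ 'n" assume u: "u \<in> sphere 0 1"
      show "a \<le> radial (Ks k) u * cone_density (Ks k) u"
        unfolding a_def cone_density_def using rad[OF u] r(1) V elim
        by (intro mult_mono frac_le power_mono) auto
      show "cone_density (Ks k) u \<le> b"
        unfolding b_def cone_density_def using rad[OF u] r(1) V elim
        by (intro mult_mono frac_le power_mono) auto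
    qed
    moreover have "a * (c * norm (Bs k)) \<le> a * (\<integral>u. norm (Bs k *v u) \<partial>sphere_measure)"
      using a c(2) by (intro mult_left_mono) auto
    ultimately have "a * c * norm (Bs k) \<le> b * ?s + 1" by (simp add: mult.assoc)
    then show ?case using a c(1) by (simp add: field_simps)
  qed
  then show ?thesis by (rule BfunI)
qed

lemma ex_optimal_matrix:
  fixes K :: "(real ^ 'n) set"
  assumes \<phi>: "\<phi> \<in> Orlicz_class" and K: "star_body K"
  shows "\<exists>B. optimal_matrix \<phi> K B"
proof -
  let ?F = "{B. Orlicz_energy \<phi> K B \<le> \<phi> 1}"
  have "bounded ?F"
  proof (rule ccontr)
    assume "\<not> bounded ?F"
    then have "\<forall>k :: nat. \<exists>B. B \<in> ?F \<and> real k < norm B"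
      unfolding bounded_iff by (metis not_le)
    then obtain Bs where Bs: "\<And>k. Bs k \<in> ?F" "\<And>k. real k < norm (Bs k)"
      by metis
    \<comment> \<open>The constant sequences of bodies and functions bring boundedness for a single
      problem under the sequential lemma.\<close>
    have "Bseq Bs"
      by (rule feasible_imp_Bseq[of K "\<lambda>_. K" "\<lambda>_. \<phi>"])
        (use Bs(1) \<phi> K in \<open>auto simp: dual_hausdorff_self\<close>)
    then obtain M where "\<And>k. norm (Bs k) \<le> M" unfolding Bseq_def by blast
    moreover obtain k where "M < real k" using reals_Archimedean2 by blast
    ultimately show False using Bs(2)[of k] by (meson not_le order_less_trans)
  qed
  moreover have "closed ?F"
    unfolding closed_sequential_limits
  proof (intro allI impI)
    fix Bs L assume "(\<forall>k. Bs k \<in> ?F) \<and> Bs \<longlonglongrightarrow> L"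
    then show "L \<in> ?F"
      using LIMSEQ_le_const2[OF Orlicz_energy_tendsto_const[OF \<phi> K, of Bs L]] by auto
  qed
  ultimately have "compact ?F" by (simp add: compact_eq_bounded_closed)
  moreover have "?F \<noteq> {}" using ex_feasible_scaled_identity[OF \<phi> K] by blast
  moreover have "continuous_on ?F (\<lambda>B. \<bar>det B\<bar>)"
    unfolding continuous_on_def by (intro ballI tendsto_rabs tendsto_det tendsto_ident_at)
  ultimately obtain B where "B \<in> ?F" "\<And>B'. B' \<in> ?F \<Longrightarrow> \<bar>det B'\<bar> \<le> \<bar>det B\<bar>"
    using continuous_attains_sup[of ?F "\<lambda>B. \<bar>det B\<bar>"] by blast
  then show ?thesis by (auto simp: optimal_matrix_def)
qed

lemma Orlicz_energy_orthogonal_mult: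
  assumes "orthogonal_matrix Q"
  shows "Orlicz_energy \<phi> K (Q ** A) = Orlicz_energy \<phi> K A"
  using assms
  by (simp add: Orlicz_energy_def matrix_vector_mul_assoc[symmetric] norm_orthogonal_matrix_mult)

lemma optimal_matrix_unique:
  fixes K :: "(real ^ 'n) set"
  assumes \<phi>: "\<phi> \<in> Orlicz_class" and K: "star_body K"
    and A: "optimal_matrix \<phi> K A" and B: "optimal_matrix \<phi> K B"
  shows "ellipsoid_of A = ellipsoid_of B"
proof -
  have det: "\<bar>det A\<bar> = \<bar>det B\<bar>"
    using A B by (auto simp: optimal_matrix_def intro: antisym)
  have "norm (A *v x) = norm (B *v x)" for x
  proof (rule ccontr)
    assume ne: "norm (A *v x) \<noteq> norm (B *v x)"
    obtain Q where Q: "orthogonal_matrix Q" and gt: "\<bar>det B\<bar> < \<bar>det ((1/2) *\<^sub>R (Q ** A + B))\<bar>"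
      by (rule abs_det_midpoint_gt[OF optimal_matrix_invertible[OF \<phi> K B] det ne])
    \<comment> \<open>Rotating \<open>A\<close> by \<open>Q\<close> leaves its energy unchanged, so
      the midpoint is feasible by convexity and its larger determinant contradicts optimality of
      \<open>B\<close>.\<close>
    have "Orlicz_energy \<phi> K ((1/2) *\<^sub>R (Q ** A + B)) \<le> \<phi> 1"
      using Orlicz_energy_midpoint_le[OF \<phi> K, of "Q ** A" B] A B
      by (simp add: Orlicz_energy_orthogonal_mult[OF Q] optimal_matrix_def)
    with B have "\<bar>det ((1/2) *\<^sub>R (Q ** A + B))\<bar> \<le> \<bar>det B\<bar>"
      by (simp add: optimal_matrix_def)
    with gt show False by linarith
  qed
  then show ?thesis by (simp add: ellipsoid_of_def)
qed

lemma is_Orlicz_Legendre_ellipsoid_iff: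
  fixes K :: "(real ^ 'n) set"
  assumes \<phi>: "\<phi> \<in> Orlicz_class" and K: "star_body K"
  shows "is_Orlicz_Legendre_ellipsoid \<phi> K E \<longleftrightarrow> (\<exists>B. optimal_matrix \<phi> K B \<and> E = ellipsoid_of B)"
proof -
  have vol_le: "vol (ellipsoid_of B) \<le> vol (ellipsoid_of B') \<longleftrightarrow> \<bar>det B'\<bar> \<le> \<bar>det B\<bar>"
    if "invertible B" "invertible B'" for B B' :: "real ^ 'n ^ 'n"
  proof -
    have "0 < \<bar>det B\<bar>" "0 < \<bar>det B'\<bar>" using that by (auto simp: invertible_det_nz)
    moreover have "0 < measure lebesgue (cball (0 :: real ^ 'n) 1)"
      using content_cball_pos[of 1 "0 :: real ^ 'n"] by simp
    ultimately show ?thesis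
      by (simp add: vol_ellipsoid_of that divide_le_cancel frac_le_eq field_simps)
  qed
  note feas = Orlicz_functional_le_one_iff[OF \<phi> K]
  show ?thesis
  proof
    assume L: "is_Orlicz_Legendre_ellipsoid \<phi> K E"
    then obtain B where B: "invertible B" "E = ellipsoid_of B"
      by (auto simp: is_Orlicz_Legendre_ellipsoid_def ellipsoid_iff)
    have "\<bar>det B'\<bar> \<le> \<bar>det B\<bar>" if B': "Orlicz_energy \<phi> K B' \<le> \<phi> 1" for B'
    proof (cases "invertible B'")
      case True
      then have "vol E \<le> vol (ellipsoid_of B')"
        using L B' feas[OF True] by (auto simp: is_Orlicz_Legendre_ellipsoid_def ellipsoid_iff)
      then show ?thesis using vol_le[OF B(1) True] B(2) by simp
    next
      case False
      then show ?thesis by (simp add: invertible_det_nz)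
    qed
    moreover have "Orlicz_energy \<phi> K B \<le> \<phi> 1"
      using L feas[OF B(1)] B(2) by (simp add: is_Orlicz_Legendre_ellipsoid_def)
    ultimately show "\<exists>B. optimal_matrix \<phi> K B \<and> E = ellipsoid_of B"
      using B(2) by (auto simp: optimal_matrix_def)
  next
    assume "\<exists>B. optimal_matrix \<phi> K B \<and> E = ellipsoid_of B"
    then obtain B where B: "optimal_matrix \<phi> K B" "E = ellipsoid_of B" by blast
    note inv = optimal_matrix_invertible[OF \<phi> K B(1)]
    show "is_Orlicz_Legendre_ellipsoid \<phi> K E"
      unfolding is_Orlicz_Legendre_ellipsoid_def
    proof (intro conjI allI impI)
      show "ellipsoid E" using inv B(2) by (auto simp: ellipsoid_iff)
      show "Orlicz_functional \<phi> K E \<le> 1"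
        using B feas[OF inv] by (simp add: optimal_matrix_def)
      fix E' assume E': "ellipsoid E' \<and> Orlicz_functional \<phi> K E' \<le> 1"
      then obtain B' where B': "invertible B'" "E' = ellipsoid_of B'"
        by (auto simp: ellipsoid_iff)
      then show "vol E \<le> vol E'"
        using E' B feas[OF B'(1)] vol_le[OF inv B'(1)] by (simp add: optimal_matrix_def)
    qed
  qed
qed

lemma Orlicz_Legendre_ellipsoid_eq:
  assumes "\<phi> \<in> Orlicz_class" "star_body K" "optimal_matrix \<phi> K B"
  shows "Orlicz_Legendre_ellipsoid \<phi> K = ellipsoid_of B"
  unfolding Orlicz_Legendre_ellipsoid_def is_Orlicz_Legendre_ellipsoid_iff[OF assms(1,2)]
  using assms(3) optimal_matrix_unique[OF assms(1,2)] by (intro the_equality) blast+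

section \<open>Passage to the limit\<close>

lemma optimal_matrix_limit:
  fixes K :: "(real ^ 'n) set"
  assumes K: "star_body K" and Ks: "\<And>k. star_body (Ks k)"
    and dist: "(\<lambda>k. dual_hausdorff (Ks k) K) \<longlonglongrightarrow> 0"
    and \<phi>: "\<phi> \<in> Orlicz_class" and \<phi>s: "\<And>k. \<phi>s k \<in> Orlicz_class" and lim: "Orlicz_tendsto \<phi>s \<phi>"
    and opt: "\<And>k. optimal_matrix (\<phi>s k) (Ks k) (Bs k)" and L: "Bs \<longlonglongrightarrow> L"
  shows "optimal_matrix \<phi> K L"
  unfolding optimal_matrix_def
proof (intro conjI allI impI)
  have one: "(\<lambda>k. \<phi>s k 1) \<longlonglongrightarrow> \<phi> 1"
    by (intro Orlicz_tendsto_at[OF \<phi> lim]) auto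
  note energy = Orlicz_energy_tendsto[OF K Ks dist \<phi> \<phi>s lim]
  show "Orlicz_energy \<phi> K L \<le> \<phi> 1"
    using opt by (intro LIMSEQ_le[OF energy[OF L] one]) (auto simp: optimal_matrix_def)
  fix B assume B: "Orlicz_energy \<phi> K B \<le> \<phi> 1"
  \<comment> \<open>A feasible \<open>B\<close> for the limit problem may fail the approximating
    constraints; the slack of \<open>t *\<^sub>R B\<close> survives for large \<open>k\<close>, and
    \<open>t\<close> tends to \<open>1\<close> afterwards.\<close>
  have "t ^ CARD('n) * \<bar>det B\<bar> \<le> \<bar>det L\<bar>" if t: "0 < t" "t < 1" for t
  proof -
    have "Orlicz_energy \<phi> K (t *\<^sub>R B) \<le> t * Orlicz_energy \<phi> K B"
      using t by (intro Orlicz_energy_scaleR_le[OF \<phi> K]) auto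
    also have "\<dots> \<le> t * \<phi> 1" using t B by (intro mult_left_mono) auto
    also have "\<dots> < \<phi> 1" using t Orlicz_one_pos[OF \<phi>] by simp
    finally have "0 < \<phi> 1 - Orlicz_energy \<phi> K (t *\<^sub>R B)" by simp
    with tendsto_diff[OF one energy[OF tendsto_const]]
    have "\<forall>\<^sub>F k in sequentially. 0 < \<phi>s k 1 - Orlicz_energy (\<phi>s k) (Ks k) (t *\<^sub>R B)"
      by (rule order_tendstoD)
    then have "\<forall>\<^sub>F k in sequentially. \<bar>det (t *\<^sub>R B)\<bar> \<le> \<bar>det (Bs k)\<bar>"
      by eventually_elim (use opt in \<open>auto simp: optimal_matrix_def\<close>)
    moreover have "(\<lambda>k. \<bar>det (Bs k)\<bar>) \<longlonglongrightarrow> \<bar>det L\<bar>"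
      by (intro tendsto_rabs tendsto_det L)
    ultimately have "\<bar>det (t *\<^sub>R B)\<bar> \<le> \<bar>det L\<bar>"
      by (intro tendsto_lowerbound[OF _ _ sequentially_bot])
    then show ?thesis using t by (simp add: det_scaleR abs_mult)
  qed
  then have "\<forall>\<^sub>F t in at_left 1. t ^ CARD('n) * \<bar>det B\<bar> \<le> \<bar>det L\<bar>"
    using eventually_at_left_real[of 0 1] by (auto elim!: eventually_mono)
  moreover have "((\<lambda>t. t ^ CARD('n) * \<bar>det B\<bar>) \<longlongrightarrow> 1 ^ CARD('n) * \<bar>det B\<bar>) (at_left 1)"
    by (intro tendsto_intros)
  ultimately have "1 ^ CARD('n) * \<bar>det B\<bar> \<le> \<bar>det L\<bar>"
    by (intro tendsto_upperbound) auto
  then show "\<bar>det B\<bar> \<le> \<bar>det L\<bar>" by simp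
qed

text \<open>Optimal matrices are determined only up to a left orthogonal factor, so the chosen
  \<open>Bs\<close> need not converge. Boundedness gives a convergent subsequence, and uniqueness
  identifies the ellipsoid of its limit.\<close>

lemma Orlicz_Legendre_ellipsoid_subseq:
  fixes K :: "(real ^ 'n) set"
  assumes K: "star_body K" and Ks: "\<And>k. star_body (Ks k)"
    and dist: "(\<lambda>k. dual_hausdorff (Ks k) K) \<longlonglongrightarrow> 0"
    and \<phi>: "\<phi> \<in> Orlicz_class" and \<phi>s: "\<And>k. \<phi>s k \<in> Orlicz_class" and lim: "Orlicz_tendsto \<phi>s \<phi>"
  obtains r :: "nat \<Rightarrow> nat" where "strict_mono r"
    "(\<lambda>k. dual_hausdorff (Orlicz_Legendre_ellipsoid (\<phi>s (r k)) (Ks (r k)))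
                         (Orlicz_Legendre_ellipsoid \<phi> K)) \<longlonglongrightarrow> 0"
proof -
  have "\<forall>k. \<exists>B. optimal_matrix (\<phi>s k) (Ks k) B"
    using ex_optimal_matrix[OF \<phi>s Ks] by simp
  from choice[OF this] obtain Bs where opt: "\<And>k. optimal_matrix (\<phi>s k) (Ks k) (Bs k)" by blast
  then have "Bseq Bs"
    by (intro feasible_imp_Bseq[where \<phi>s = \<phi>s, OF K Ks dist \<phi>s]) (simp add: optimal_matrix_def)
  then obtain M where M: "\<And>k. norm (Bs k) \<le> M" unfolding Bseq_def by blast
  then have "\<forall>k. Bs k \<in> cball 0 M" by simp
  with compact_cball[THEN compact_imp_seq_compact] obtain L r where
    "L \<in> cball 0 M" and r: "strict_mono r" and L: "(Bs \<circ> r) \<longlonglongrightarrow> L"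
    by (rule seq_compactE)
  have r_top: "filterlim r at_top sequentially" by (rule filterlim_subseq[OF r])
  have "optimal_matrix \<phi> K L"
  proof (rule optimal_matrix_limit[of K "\<lambda>k. Ks (r k)" \<phi> "\<lambda>k. \<phi>s (r k)" "Bs \<circ> r"])
    show "(\<lambda>k. dual_hausdorff (Ks (r k)) K) \<longlonglongrightarrow> 0"
      by (rule filterlim_compose[OF dist r_top])
    show "Orlicz_tendsto (\<lambda>k. \<phi>s (r k)) \<phi>" by (rule Orlicz_tendsto_subseq[OF lim r_top])
  qed (use K Ks \<phi> \<phi>s opt L in auto)
  then have eqs: "Orlicz_Legendre_ellipsoid \<phi> K = ellipsoid_of L" "invertible L"
    using Orlicz_Legendre_ellipsoid_eq optimal_matrix_invertible \<phi> K by blast+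
  have "Orlicz_Legendre_ellipsoid (\<phi>s k) (Ks k) = ellipsoid_of (Bs k)" "invertible (Bs k)" for k
    using Orlicz_Legendre_ellipsoid_eq[OF \<phi>s Ks opt] optimal_matrix_invertible[OF \<phi>s Ks opt] by auto
  with dual_hausdorff_ellipsoid_of_tendsto[OF L] eqs r show ?thesis
    by (intro that[of r]) simp_all
qed

theorem theorem5p6:
  fixes K :: "(real ^ 'n) set" and Ks :: "nat \<Rightarrow> (real ^ 'n) set"
    and \<phi> :: "real \<Rightarrow> real" and \<phi>s :: "nat \<Rightarrow> real \<Rightarrow> real"
  assumes "star_body K" and "\<And>i. star_body (Ks i)"
    and "\<phi> \<in> Orlicz_class" and "\<And>j. \<phi>s j \<in> Orlicz_class"
    and "(\<lambda>i. dual_hausdorff (Ks i) K) \<longlonglongrightarrow> 0"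
    and "Orlicz_tendsto \<phi>s \<phi>"
  shows "((\<lambda>(i, j). dual_hausdorff (Orlicz_Legendre_ellipsoid (\<phi>s j) (Ks i))
                                   (Orlicz_Legendre_ellipsoid \<phi> K))
           \<longlongrightarrow> 0) (sequentially \<times>\<^sub>F sequentially)"
proof (rule tendstoI, rule ccontr)
  let ?d = "\<lambda>i j. dual_hausdorff (Orlicz_Legendre_ellipsoid (\<phi>s j) (Ks i))
                                 (Orlicz_Legendre_ellipsoid \<phi> K)"
  fix e :: real
  assume e: "0 < e" and "\<not> (\<forall>\<^sub>F x in sequentially \<times>\<^sub>F sequentially.
    dist (case x of (i, j) \<Rightarrow> ?d i j) 0 < e)"
  \<comment> \<open>Failure of the joint limit yields bad index pairs beyond every \<open>N\<close>.
    Choosing one pair for each \<open>N\<close> reduces the double limit to a single sequence;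
    \<open>p\<close> and \<open>q\<close> tend to infinity but need not be monotone.\<close>
  then have "\<forall>N. \<exists>j\<ge>N. \<exists>i\<ge>N. e \<le> \<bar>?d i j\<bar>"
    unfolding eventually_prod_sequentially by (auto simp: not_less)
  then obtain p q where pq: "\<And>N. N \<le> p N" "\<And>N. N \<le> q N" "\<And>N. e \<le> \<bar>?d (p N) (q N)\<bar>"
    by metis
  have top: "filterlim p at_top sequentially" "filterlim q at_top sequentially"
    using pq(1,2) by (auto intro!: filterlim_at_top_mono[OF filterlim_ident])
  obtain r where "strict_mono r" and r: "(\<lambda>k. ?d (p (r k)) (q (r k))) \<longlonglongrightarrow> 0"
    using Orlicz_Legendre_ellipsoid_subseq[of K "\<lambda>k. Ks (p k)" \<phi> "\<lambda>k. \<phi>s (q k)",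
        OF assms(1,2) filterlim_compose[OF assms(5) top(1)] assms(3,4)
          Orlicz_tendsto_subseq[OF assms(6) top(2)]] by blast
  have "\<forall>\<^sub>F k in sequentially. \<bar>?d (p (r k)) (q (r k))\<bar> < e"
    using tendstoD[OF r e] by (simp add: dist_norm)
  then obtain k where "\<bar>?d (p (r k)) (q (r k))\<bar> < e"
    using eventually_happens'[OF sequentially_bot] by blast
  with pq(3)[of "r k"] show False by simp
qed

end
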